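(* Let $p$ be an odd prime. There exist groups $G_1$ and $G_2$, each generated by two elements and of rank two, neither isomorphic to $C_p * C_p$, such that for all $i \geq 1$ $$G_1/\gamma_i(G_1) \cong G_2/\gamma_i(G_2) \cong (C_p*C_p)/\gamma_i(C_p*C_p).$$ Moreover, $G_1$ is residually nilpotent and $G_2$ is not residually nilpotent.
   Context: $C_p$ is the cyclic group of order $p$. The lower central series is $\gamma_1(G)=G$, $\gamma_k(G)=[G,\gamma_{k-1}(G)]$. A group $G$ is residually nilpotent if $\bigcap_{k\ge1}\gamma_k(G)=\{1\}$. The rank of a group is the minimum size of a generating set. *)

theory Defs
  imports "HOL-Algebra.Algebra"
begin

text \<open>A letter (b,k) stands for the k-th power of the generator of the first
(b = False) or second (b = True) cyclic factor C_p. A word is reduced if all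
exponents lie in {1..p-1} and consecutive letters come from different factors.\<close>

fun cp_reduced :: "nat \<Rightarrow> (bool \<times> nat) list \<Rightarrow> bool" where
  "cp_reduced p [] = True"
| "cp_reduced p [(b,k)] = (0 < k \<and> k < p)"
| "cp_reduced p ((b,k) # (c,l) # w) = (0 < k \<and> k < p \<and> b \<noteq> c \<and> cp_reduced p ((c,l) # w))"

fun cp_cons :: "nat \<Rightarrow> bool \<times> nat \<Rightarrow> (bool \<times> nat) list \<Rightarrow> (bool \<times> nat) list" where
  "cp_cons p (b,k) [] = (if k mod p = 0 then [] else [(b, k mod p)])"
| "cp_cons p (b,k) ((c,l) # w) =
     (if b = c then (if (k + l) mod p = 0 then w else (b, (k + l) mod p) # w)
      else (if k mod p = 0 then (c,l) # w else (b, k mod p) # (c,l) # w))"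

definition cp_mult :: "nat \<Rightarrow> (bool \<times> nat) list \<Rightarrow> (bool \<times> nat) list \<Rightarrow> (bool \<times> nat) list" where
  "cp_mult p u v = foldr (cp_cons p) u v"

definition CpCp :: "nat \<Rightarrow> (bool \<times> nat) list monoid" where
  "CpCp p = \<lparr> carrier = {w. cp_reduced p w}, monoid.mult = cp_mult p, one = [] \<rparr>"

definition commutator_set :: "('a, 'b) monoid_scheme \<Rightarrow> 'a set \<Rightarrow> 'a set \<Rightarrow> 'a set" where
  "commutator_set G A B =
     {x \<otimes>\<^bsub>G\<^esub> y \<otimes>\<^bsub>G\<^esub> inv\<^bsub>G\<^esub> x \<otimes>\<^bsub>G\<^esub> inv\<^bsub>G\<^esub> y | x y. x \<in> A \<and> y \<in> B}"

text \<open>gamma_1(G) = G, gamma_(k+1)(G) = [G, gamma_k(G)]. (Index 0 is set to G as well;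
only indices >= 1 are used.)\<close>
fun lower_central :: "('a, 'b) monoid_scheme \<Rightarrow> nat \<Rightarrow> 'a set" where
  "lower_central G 0 = carrier G"
| "lower_central G (Suc 0) = carrier G"
| "lower_central G (Suc (Suc k)) =
     generate G (commutator_set G (carrier G) (lower_central G (Suc k)))"

definition residually_nilpotent :: "('a, 'b) monoid_scheme \<Rightarrow> bool" where
  "residually_nilpotent G \<longleftrightarrow> (\<Inter>k\<in>{1..}. lower_central G k) = {\<one>\<^bsub>G\<^esub>}"

definition group_rank :: "('a, 'b) monoid_scheme \<Rightarrow> nat" where
  "group_rank G = (LEAST n. \<exists>S. S \<subseteq> carrier G \<and> finite S \<and> card S = n \<and> generate G S = carrier G)"

end

theory Submission
  imports Defs "HOL-Number_Theory.Residues" "HOL-Library.Countable_Set"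
begin

text \<open>Write \<open>F = C\<^sub>p * C\<^sub>p\<close> with generators \<open>x\<close>, \<open>y\<close> and consider the equation \<open>b [b, x] = y\<close>.
In a nilpotent group it has exactly one solution \<open>b\<close>. Let \<open>G\<^sub>1\<close> be the subgroup of the product of all
\<open>F/\<gamma>\<^sub>i(F)\<close> generated by \<open>x\<close> and the solution \<open>b\<close>. It is residually nilpotent and contains \<open>F/\<Inter>\<gamma>\<^sub>i(F)\<close>;
existence of solutions in \<open>F\<close> modulo \<open>\<gamma>\<^sub>i(F)\<close> and uniqueness modulo \<open>\<gamma>\<^sub>i(G\<^sub>1)\<close> show that \<open>b\<close> agrees
modulo \<open>\<gamma>\<^sub>i(G\<^sub>1)\<close> with an element coming from \<open>F\<close>, so that \<open>F\<close> and \<open>G\<^sub>1\<close> have the same nilpotent quotients.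
Let \<open>G\<^sub>2\<close> be the semidirect product of \<open>N = \<int>/(2\<^sup>p - 1)\<close> and \<open>F\<close> where \<open>x\<close> doubles and \<open>y\<close> is trivial;
then \<open>[N, x] = N\<close>, so \<open>N\<close> lies in every \<open>\<gamma>\<^sub>i(G\<^sub>2)\<close>.
Neither group is isomorphic to \<open>F\<close>: if \<open>x\<close> has order \<open>p\<close> in \<open>F\<close> and \<open>(b [b, x])\<^sup>p = 1\<close>, then normal forms
and \<open>p\<close> odd force \<open>b\<close> to be a power of \<open>x\<close>. This fails in \<open>G\<^sub>1\<close>, where \<open>b [b, x] = y\<close>, and in \<open>G\<^sub>2\<close>,
where \<open>b [b, x] = 1\<close> for every \<open>b\<close> of \<open>N\<close>.\<close>

section \<open>Lower central series\<close>

context group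
begin

lemma mult_inv_cancel [simp]:
  assumes "x \<in> carrier G" "y \<in> carrier G"
  shows "x \<otimes> (inv x \<otimes> y) = y" "inv x \<otimes> (x \<otimes> y) = y"
  using assms by (simp_all flip: m_assoc)

lemma pow_conj:
  assumes "g \<in> carrier G" "x \<in> carrier G"
  shows "(g \<otimes> x \<otimes> inv g) [^] (n::nat) = g \<otimes> x [^] n \<otimes> inv g"
  by (induction n) (use assms in \<open>auto simp: m_assoc inv_mult_group\<close>)

lemma conj_eq_one:
  assumes "g \<in> carrier G" "x \<in> carrier G"
  shows "g \<otimes> x \<otimes> inv g = \<one> \<longleftrightarrow> x = \<one>"
proof
  assume "g \<otimes> x \<otimes> inv g = \<one>"
  then have "inv g \<otimes> (g \<otimes> x \<otimes> inv g) \<otimes> g = inv g \<otimes> \<one> \<otimes> g"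
    by simp
  then show "x = \<one>"
    using assms by (simp add: m_assoc)
qed (use assms in simp)

text \<open>This is the word \<open>b [b, x]\<close>.\<close>

definition rel :: "'a \<Rightarrow> 'a \<Rightarrow> 'a" where
  "rel x b = b \<otimes> b \<otimes> x \<otimes> inv b \<otimes> inv x"

lemma rel_closed [simp, intro]:
  "x \<in> carrier G \<Longrightarrow> b \<in> carrier G \<Longrightarrow> rel x b \<in> carrier G"
  by (simp add: rel_def)

lemma rel_conj:
  assumes "g \<in> carrier G" "x \<in> carrier G" "b \<in> carrier G"
  shows "rel (g \<otimes> x \<otimes> inv g) (g \<otimes> b \<otimes> inv g) = g \<otimes> rel x b \<otimes> inv g"
  using assms by (simp add: rel_def m_assoc inv_mult_group)

end

lemma hom_rel:
  assumes "group G" "group H" "h \<in> hom G H" "x \<in> carrier G" "b \<in> carrier G"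
  shows "h (group.rel G x b) = group.rel H (h x) (h b)"
proof -
  interpret group_hom G H h
    using assms by (simp add: group_hom_def group_hom_axioms_def)
  show ?thesis
    using assms by (simp add: group.rel_def)
qed

lemma hom_commutator_set:
  assumes "group G" "group H" "h \<in> hom G H" "A \<subseteq> carrier G" "B \<subseteq> carrier G"
  shows "commutator_set H (h ` A) (h ` B) = h ` commutator_set G A B"
proof -
  interpret group_hom G H h
    using assms by (simp add: group_hom_def group_hom_axioms_def)
  have *: "h x \<otimes>\<^bsub>H\<^esub> h y \<otimes>\<^bsub>H\<^esub> inv\<^bsub>H\<^esub> h x \<otimes>\<^bsub>H\<^esub> inv\<^bsub>H\<^esub> h y = h (x \<otimes>\<^bsub>G\<^esub> y \<otimes>\<^bsub>G\<^esub> inv\<^bsub>G\<^esub> x \<otimes>\<^bsub>G\<^esub> inv\<^bsub>G\<^esub> y)"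
    if "x \<in> A" "y \<in> B" for x y
    using that assms(4,5) by (simp add: subset_iff)
  show ?thesis
  proof (intro equalityI subsetI)
    fix z assume "z \<in> commutator_set H (h ` A) (h ` B)"
    then obtain x y where "x \<in> A" "y \<in> B"
      "z = h x \<otimes>\<^bsub>H\<^esub> h y \<otimes>\<^bsub>H\<^esub> inv\<^bsub>H\<^esub> h x \<otimes>\<^bsub>H\<^esub> inv\<^bsub>H\<^esub> h y"
      by (auto simp: commutator_set_def)
    with * show "z \<in> h ` commutator_set G A B"
      by (auto simp: commutator_set_def)
  next
    fix z assume "z \<in> h ` commutator_set G A B"
    then obtain x y where "x \<in> A" "y \<in> B"
      "z = h (x \<otimes>\<^bsub>G\<^esub> y \<otimes>\<^bsub>G\<^esub> inv\<^bsub>G\<^esub> x \<otimes>\<^bsub>G\<^esub> inv\<^bsub>G\<^esub> y)"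
      by (auto simp: commutator_set_def)
    with *[of x y] show "z \<in> commutator_set H (h ` A) (h ` B)"
      unfolding commutator_set_def mem_Collect_eq by (intro exI[of _ "h x"] exI[of _ "h y"]) simp
  qed
qed

lemma commutator_set_mono: "A \<subseteq> A' \<Longrightarrow> B \<subseteq> B' \<Longrightarrow> commutator_set G A B \<subseteq> commutator_set G A' B'"
  by (auto simp: commutator_set_def)

lemma (in group) commutator_set_in_carrier:
  "A \<subseteq> carrier G \<Longrightarrow> B \<subseteq> carrier G \<Longrightarrow> commutator_set G A B \<subseteq> carrier G"
  by (force simp: commutator_set_def)

text \<open>A conjugate of a commutator is the commutator of the conjugates, and by induction the
  conjugated second entry stays in the previous term. The generating set is therefore invariant
  under conjugation.\<close>

lemma (in group) lower_central_normal: "lower_central G k \<lhd> G"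
proof (induction k rule: induct_nat_012)
  case (ge2 k)
  let ?K = "lower_central G (Suc k)"
  interpret K: normal ?K G
    by (rule ge2)
  have "g \<otimes> c \<otimes> inv g \<in> commutator_set G (carrier G) ?K"
    if c: "c \<in> commutator_set G (carrier G) ?K" and g: "g \<in> carrier G" for c g
  proof -
    obtain x y where xy: "x \<in> carrier G" "y \<in> ?K" and c: "c = x \<otimes> y \<otimes> inv x \<otimes> inv y"
      using c by (auto simp: commutator_set_def)
    have y: "y \<in> carrier G"
      using K.subset xy by blast
    have "g \<otimes> c \<otimes> inv g = (g \<otimes> x \<otimes> inv g) \<otimes> (g \<otimes> y \<otimes> inv g) \<otimes> inv (g \<otimes> x \<otimes> inv g) \<otimes> inv (g \<otimes> y \<otimes> inv g)"
      using xy y g unfolding c by (simp add: m_assoc inv_mult_group)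
    moreover have "g \<otimes> x \<otimes> inv g \<in> carrier G" "g \<otimes> y \<otimes> inv g \<in> ?K"
      using xy g K.inv_op_closed2 by auto
    ultimately show ?thesis
      unfolding commutator_set_def by blast
  qed
  then show ?case
    using normal_generateI[OF commutator_set_in_carrier[OF subset_refl K.subset]] by simp
qed (simp_all add: normal_self)

lemma (in group) lower_central_subset: "lower_central G k \<subseteq> carrier G"
  by (intro subgroup.subset normal.axioms(1) lower_central_normal)

lemma (in group) commutator_in_lower_central:
  assumes "x \<in> carrier G" "y \<in> lower_central G (Suc k)"
  shows "x \<otimes> y \<otimes> inv x \<otimes> inv y \<in> lower_central G (Suc (Suc k))"
  using assms by (auto simp: commutator_set_def intro!: generate.incl)

text \<open>A commutator with \<open>y\<close> is a conjugate of \<open>y\<close> times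
  \<open>inv y\<close>, and both lie in any normal subgroup containing \<open>y\<close>.\<close>

lemma (in group) lower_central_Suc_subset: "lower_central G (Suc k) \<subseteq> lower_central G k"
proof (cases k)
  case (Suc l)
  interpret K: normal "lower_central G (Suc l)" G
    by (rule lower_central_normal)
  have "x \<otimes> y \<otimes> inv x \<otimes> inv y \<in> lower_central G (Suc l)"
    if "x \<in> carrier G" "y \<in> lower_central G (Suc l)" for x y
    using that K.inv_op_closed2 K.m_closed K.m_inv_closed by simp
  then have "commutator_set G (carrier G) (lower_central G (Suc l)) \<subseteq> lower_central G (Suc l)"
    unfolding commutator_set_def by blast
  then show ?thesis
    using generate_subgroup_incl[OF _ K.subgroup_axioms] Suc by simp
qed simp

declare lower_central.simps(3) [simp del]

lemma lower_central_hom: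
  assumes "group G" "group H" "h \<in> hom G H"
  shows "h ` lower_central G k \<subseteq> lower_central H k"
proof (induction k rule: induct_nat_012)
  case (ge2 k)
  interpret group_hom G H h
    using assms by (simp add: group_hom_def group_hom_axioms_def)
  have "h ` lower_central G (Suc (Suc k)) =
      generate H (commutator_set H (h ` carrier G) (h ` lower_central G (Suc k)))"
    unfolding lower_central.simps
    using assms hom_commutator_set[of G H h "carrier G" "lower_central G (Suc k)"]
      generate_img[OF G.commutator_set_in_carrier[OF subset_refl G.lower_central_subset]]
    by (simp add: G.lower_central_subset)
  also have "\<dots> \<subseteq> lower_central H (Suc (Suc k))"
    unfolding lower_central.simps
  proof (rule H.mono_generate, rule commutator_set_mono)
    show "h ` carrier G \<subseteq> carrier H"
      using assms(3) by (auto simp: hom_def)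
  qed (rule ge2)
  finally show ?case .
qed (use assms in \<open>auto simp: hom_def\<close>)

text \<open>Under a surjection the commutator sets correspond exactly, which turns the inclusion of
  \<open>lower_central_hom\<close> into an equality.\<close>

lemma lower_central_epi:
  assumes "group G" "group H" "h \<in> hom G H" "h ` carrier G = carrier H"
  shows "h ` lower_central G k = lower_central H k"
proof (induction k rule: induct_nat_012)
  case (ge2 k)
  interpret group_hom G H h
    using assms by (simp add: group_hom_def group_hom_axioms_def)
  show ?case
    unfolding lower_central.simps
    using assms hom_commutator_set[of G H h "carrier G" "lower_central G (Suc k)"] ge2
      generate_img[OF G.commutator_set_in_carrier[OF subset_refl G.lower_central_subset]]
    by (simp add: G.lower_central_subset)
qed (use assms in auto)

section \<open>Cosets of the lower central series and the equation
  \<open>rel x b = y\<close>\<close>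

context group
begin

text \<open>Normality allows passing to left cosets, so the quotient of the representatives can be
  written \<open>inv u \<otimes> v\<close>. This suits corrections that are multiplied on the
  right.\<close>

lemma normal_rcos_eq_iff:
  assumes "N \<lhd> G" "u \<in> carrier G" "v \<in> carrier G"
  shows "N #> u = N #> v \<longleftrightarrow> inv u \<otimes> v \<in> N"
proof -
  interpret N: normal N G by fact
  have "N #> u = N #> v \<longleftrightarrow> u <# N = v <# N"
    using N.coset_eq assms by simp
  also have "\<dots> \<longleftrightarrow> v \<in> u <# N"
    using assms N.subgroup_axioms l_repr_independence[of v u N] lcos_self[of v N] by auto
  also have "\<dots> \<longleftrightarrow> inv u \<otimes> v \<in> N"
  proof
    assume "v \<in> u <# N"
    then obtain n where "n \<in> N" "v = u \<otimes> n"
      by (auto simp: l_coset_def)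
    then show "inv u \<otimes> v \<in> N"
      using assms N.mem_carrier by simp
  next
    assume "inv u \<otimes> v \<in> N"
    then show "v \<in> u <# N"
      using assms by (auto simp: l_coset_def intro!: bexI[of _ "inv u \<otimes> v"])
  qed
  finally show ?thesis .
qed

lemma normal_rcos_eq_self_iff:
  "N \<lhd> G \<Longrightarrow> v \<in> carrier G \<Longrightarrow> N #> v = N \<longleftrightarrow> v \<in> N"
  using coset_join1[of N v] coset_join2[of v N] normal_imp_subgroup[of N] by blast

text \<open>In the word, \<open>b\<close> occurs with exponents 1, 1 and -1, so a central factor of
  \<open>b\<close> comes out with total exponent 1.\<close>

lemma rel_mult_central:
  assumes "x \<in> carrier G" "b \<in> carrier G" "z \<in> carrier G"
    and "\<And>g. g \<in> carrier G \<Longrightarrow> z \<otimes> g = g \<otimes> z"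
  shows "rel x (b \<otimes> z) = rel x b \<otimes> z"
proof -
  have 1: "z \<otimes> (g \<otimes> h) = g \<otimes> (z \<otimes> h)" if "g \<in> carrier G" "h \<in> carrier G" for g h
  proof -
    have "z \<otimes> (g \<otimes> h) = (z \<otimes> g) \<otimes> h"
      using that assms(3) by (simp add: m_assoc)
    also have "\<dots> = g \<otimes> (z \<otimes> h)"
      using that assms(3) by (simp add: assms(4) m_assoc)
    finally show ?thesis .
  qed
  have "rel x (b \<otimes> z) = b \<otimes> (z \<otimes> (b \<otimes> (z \<otimes> (x \<otimes> (inv z \<otimes> (inv b \<otimes> inv x))))))"
    using assms(1-3) by (simp add: rel_def m_assoc inv_mult_group)
  also have "\<dots> = b \<otimes> (b \<otimes> (x \<otimes> (z \<otimes> (z \<otimes> (inv z \<otimes> (inv b \<otimes> inv x))))))"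
    using assms(1-3) by (simp only: 1[OF assms(1)] 1[OF assms(2)] m_closed inv_closed)
  also have "\<dots> = rel x b \<otimes> z"
    using assms by (simp add: rel_def m_assoc)
  finally show ?thesis .
qed

text \<open>Powers of \<open>x\<close> commute with \<open>x\<close>, so the commutator factor of
  the word vanishes.\<close>

lemma rel_pow:
  assumes "x \<in> carrier G" shows "rel x (x [^] (k::nat)) = x [^] k"
proof -
  have "rel x (x [^] k) = x [^] k \<otimes> (x [^] k \<otimes> x) \<otimes> inv (x [^] k) \<otimes> inv x"
    using assms by (simp add: rel_def m_assoc)
  also have "x [^] k \<otimes> x = x \<otimes> x [^] k"
    using assms nat_pow_Suc2[of x k] by simp
  finally show ?thesis
    using assms by (simp add: m_assoc)
qed

text \<open>An element of one term of the lower central series becomes central modulo the next term,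
  so \<open>rel_mult_central\<close> applies in that quotient.\<close>

lemma rcos_rel_mult:
  assumes "x \<in> carrier G" "b \<in> carrier G" "z \<in> lower_central G (Suc k)"
  shows "lower_central G (Suc (Suc k)) #> rel x (b \<otimes> z) = lower_central G (Suc (Suc k)) #> (rel x b \<otimes> z)"
proof -
  let ?N = "lower_central G (Suc (Suc k))"
  let ?Q = "G Mod ?N" and ?q = "\<lambda>a. ?N #> a"
  interpret N: normal ?N G
    by (rule lower_central_normal)
  have Q: "group ?Q" and q: "?q \<in> hom G ?Q"
    using N.factorgroup_is_group N.r_coset_hom_Mod by auto
  interpret q: group_hom G ?Q ?q
    using Q q by (simp add: group_hom_def group_hom_axioms_def)
  have z: "z \<in> carrier G"
    using assms(3) lower_central_subset by blast
  have "?q z \<otimes>\<^bsub>?Q\<^esub> c = c \<otimes>\<^bsub>?Q\<^esub> ?q z" if "c \<in> carrier ?Q" for c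
  proof -
    obtain g where g: "g \<in> carrier G" "c = ?q g"
      using \<open>c \<in> carrier ?Q\<close> by (auto simp: carrier_FactGroup)
    \<comment> \<open>This quotient is the commutator of \<open>inv g\<close> and
      \<open>inv z\<close>; the second entry lies in the same term as \<open>z\<close>, so the
      commutator lies one term further down.\<close>
    have "inv (z \<otimes> g) \<otimes> (g \<otimes> z) = inv g \<otimes> inv z \<otimes> inv (inv g) \<otimes> inv (inv z)"
      using g z by (simp add: inv_mult_group m_assoc)
    also have "\<dots> \<in> ?N"
      using g assms(3) subgroup.m_inv_closed[OF normal_imp_subgroup[OF lower_central_normal]]
      by (intro commutator_in_lower_central) auto
    finally have "?q (z \<otimes> g) = ?q (g \<otimes> z)"
      using g z by (subst normal_rcos_eq_iff) (auto intro: lower_central_normal)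
    then show ?thesis
      using g z q.hom_mult by simp
  qed
  then have "group.rel ?Q (?q x) (?q b \<otimes>\<^bsub>?Q\<^esub> ?q z) = group.rel ?Q (?q x) (?q b) \<otimes>\<^bsub>?Q\<^esub> ?q z"
    using assms z q.hom_closed by (intro group.rel_mult_central[OF Q]) auto
  then show ?thesis
    using assms z hom_rel[OF is_group Q q] q.hom_mult by (simp del: mult_FactGroup)
qed

text \<open>In a nilpotent group the map \<open>b \<mapsto> b [b, x]\<close> is a bijection: a solution modulo
\<open>\<gamma>\<^sub>k\<close> is corrected uniquely to one modulo \<open>\<gamma>\<^sub>k\<^sub>+\<^sub>1\<close>.\<close>

lemma rel_solvable:
  assumes "x \<in> carrier G" "y \<in> carrier G"
  shows "\<exists>b\<in>carrier G. lower_central G k #> rel x b = lower_central G k #> y"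
proof (induction k rule: induct_nat_012)
  case (ge2 k)
  let ?K = "lower_central G (Suc k)"
  obtain b where b: "b \<in> carrier G" "?K #> rel x b = ?K #> y"
    using ge2 by blast
  \<comment> \<open>The error of the approximate solution. Replacing \<open>b\<close> by
    \<open>b \<otimes> z\<close> multiplies the value by exactly this error, modulo the next
    term.\<close>
  define z where "z = inv (rel x b) \<otimes> y"
  have "z \<in> ?K"
    using b assms normal_rcos_eq_iff[OF lower_central_normal] by (simp add: z_def)
  moreover from this have z: "z \<in> carrier G"
    using lower_central_subset by blast
  moreover have "rel x b \<otimes> z = y"
    using b assms by (simp add: z_def)
  ultimately show ?case
    using rcos_rel_mult[of x b z k] b assms by (intro bexI[of _ "b \<otimes> z"]) auto
qed (use assms in \<open>auto simp: coset_join2 subgroup_self intro!: bexI[of _ \<one>]\<close>)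

text \<open>By induction \<open>b' = b \<otimes> z\<close> with \<open>z\<close> in the previous
  term. The two values then differ by \<open>z\<close> modulo the next term, which forces
  \<open>z\<close> into it.\<close>

lemma rel_unique:
  assumes "x \<in> carrier G" "b \<in> carrier G" "b' \<in> carrier G"
    and "lower_central G k #> rel x b = lower_central G k #> rel x b'"
  shows "lower_central G k #> b = lower_central G k #> b'"
  using assms(4)
proof (induction k rule: induct_nat_012)
  case (ge2 k)
  let ?K = "lower_central G (Suc k)" and ?N = "lower_central G (Suc (Suc k))"
  note K = normal_rcos_eq_iff[OF lower_central_normal]
  have "inv (rel x b) \<otimes> rel x b' \<in> ?N"
    using ge2.prems assms(1-3) K by simp
  then have "inv (rel x b) \<otimes> rel x b' \<in> ?K"
    using lower_central_Suc_subset by blast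
  then have "?K #> rel x b = ?K #> rel x b'"
    using assms(1-3) K by simp
  then have "?K #> b = ?K #> b'"
    by (rule ge2.IH)
  define z where "z = inv b \<otimes> b'"
  have z: "z \<in> ?K" "z \<in> carrier G" and b': "b' = b \<otimes> z"
    using \<open>?K #> b = ?K #> b'\<close> assms(1-3) K by (simp_all add: z_def)
  have "?N #> rel x b = ?N #> (rel x b \<otimes> z)"
    using ge2.prems rcos_rel_mult[OF assms(1,2) z(1)] by (simp add: b')
  then have "z \<in> ?N"
    using K[of "rel x b" "rel x b \<otimes> z"] z assms(1-3) by simp
  then show ?case
    using K assms(1-3) by (simp add: z_def)
qed (use assms(1-3) in \<open>auto simp: coset_join2 subgroup_self\<close>)

end

text \<open>The first isomorphism theorem for \<open>f\<close> followed by the projection to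
  \<open>G Mod M\<close>. Surjectivity is asked of the composite, so that the lemma covers maps such
  as \<open>emb\<close> that miss part of \<open>G\<close>.\<close>

lemma FactGroup_iso_via:
  assumes "group F" "group G" "f \<in> hom F G" "M \<lhd> G"
    and N: "N = {w \<in> carrier F. f w \<in> M}"
    and onto: "\<And>g. g \<in> carrier G \<Longrightarrow> \<exists>w\<in>carrier F. M #>\<^bsub>G\<^esub> g = M #>\<^bsub>G\<^esub> f w"
  shows "F Mod N \<cong> G Mod M"
proof -
  interpret M: normal M G by fact
  let ?h = "\<lambda>w. M #>\<^bsub>G\<^esub> f w"
  have h: "?h \<in> hom F (G Mod M)"
    using hom_compose[OF assms(3) M.r_coset_hom_Mod] by (simp add: comp_def)
  have f: "f w \<in> carrier G" if "w \<in> carrier F" for w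
    using assms(3) that by (auto simp: hom_def)
  interpret h: group_hom F "G Mod M" ?h
    using assms(1) M.factorgroup_is_group h by (simp add: group_hom_def group_hom_axioms_def)
  have "kernel F (G Mod M) ?h = N"
    using f group.normal_rcos_eq_self_iff[OF assms(2,4)] by (auto simp: kernel_def N)
  moreover have "?h ` carrier F = carrier (G Mod M)"
    using f onto by (fastforce simp: carrier_FactGroup)
  ultimately show ?thesis
    using h.FactGroup_iso by simp
qed

lemma lower_central_iso_quotient:
  assumes "group G" "group H" "h \<in> iso G H"
  shows "G Mod lower_central G k \<cong> H Mod lower_central H k"
proof (rule FactGroup_iso_via[where f = h])
  have h: "h \<in> hom G H" "h ` carrier G = carrier H" "inj_on h (carrier G)"
    using assms(3) by (auto simp: iso_iff)
  show "h \<in> hom G H" by fact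
  show "lower_central G k = {w \<in> carrier G. h w \<in> lower_central H k}"
    using group.lower_central_subset[OF assms(1), of k]
      inj_on_image_mem_iff[OF h(3) _ group.lower_central_subset[OF assms(1), of k]]
    by (auto simp flip: lower_central_epi[OF assms(1,2) h(1,2), of k])
  show "\<exists>w\<in>carrier G. lower_central H k #>\<^bsub>H\<^esub> g = lower_central H k #>\<^bsub>H\<^esub> h w"
    if "g \<in> carrier H" for g
    using that unfolding h(2)[symmetric] by auto
qed (use assms group.lower_central_normal in auto)

lemma residually_nilpotent_iso:
  assumes "group G" "group H" "h \<in> iso G H"
  shows "residually_nilpotent H \<longleftrightarrow> residually_nilpotent G"
proof -
  have h: "h \<in> hom G H" "h ` carrier G = carrier H" "inj_on h (carrier G)"
    using assms(3) by (auto simp: iso_iff)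
  have sub: "lower_central G k \<subseteq> carrier G" for k
    using assms(1) by (rule group.lower_central_subset)
  have 1: "(\<Inter>k\<in>{1..}. lower_central H k) = h ` (\<Inter>k\<in>{1..}. lower_central G k)"
    using lower_central_epi[OF assms(1,2) h(1,2)] sub
    by (subst image_INT[OF h(3)]) auto
  have 2: "{\<one>\<^bsub>H\<^esub>} = h ` {\<one>\<^bsub>G\<^esub>}"
    using hom_one[OF h(1)] assms by simp
  have 3: "(\<Inter>k\<in>{1..}. lower_central G k) \<subseteq> carrier G" "{\<one>\<^bsub>G\<^esub>} \<subseteq> carrier G"
    using sub[of 1] group.is_monoid[OF assms(1)] by auto
  show ?thesis
    unfolding residually_nilpotent_def 1 2 by (rule inj_on_image_eq_iff[OF h(3) 3])
qed

section \<open>Normal forms in the free product\<close>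

text \<open>Splits reducedness into a condition on single letters and one on neighbours, a form in
  which concatenation and reversal of words are easy to treat.\<close>

lemma cp_reduced_iff:
  "cp_reduced p w \<longleftrightarrow> (\<forall>l\<in>set w. 0 < snd l \<and> snd l < p) \<and> distinct_adj (map fst w)"
  by (induction p w rule: cp_reduced.induct) auto

lemma cp_reduced_append:
  "cp_reduced p (u @ v) \<longleftrightarrow>
     cp_reduced p u \<and> cp_reduced p v \<and> (u = [] \<or> v = [] \<or> fst (last u) \<noteq> fst (hd v))"
  by (auto simp: cp_reduced_iff distinct_adj_append_iff last_map hd_map)

lemma cp_reduced_Cons:
  "cp_reduced p (l # v) \<longleftrightarrow>
     0 < snd l \<and> snd l < p \<and> cp_reduced p v \<and> (v = [] \<or> fst l \<noteq> fst (hd v))"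
  using cp_reduced_append[of p "[l]" v] by (cases l) auto

lemma dvd_add_mod: "p dvd k \<Longrightarrow> (k + n) mod p = n mod p" for k n p :: nat
  by (metis add_0 dvd_imp_mod_0 mod_add_left_eq)

lemma cp_cons_mod: "cp_cons p (b, k mod p) w = cp_cons p (b, k) w"
  by (cases w) (auto simp: mod_simps dvd_add_mod)

lemma cp_cons_eq_Cons: "cp_reduced p (l # w) \<Longrightarrow> cp_cons p l w = l # w"
  by (cases l; cases w) (auto simp: cp_reduced_Cons)

lemma cp_cons_zero:
  assumes "cp_reduced p w" "k mod p = 0"
  shows "cp_cons p (b, k) w = w"
proof (cases w)
  case (Cons l v)
  have "(k + m) mod p = m mod p" for m
    using assms(2) by (metis add_0 mod_add_left_eq)
  with assms Cons show ?thesis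
    by (cases l) (auto simp: cp_reduced_Cons)
qed (use assms in auto)

text \<open>The exponents of letters from one factor add up modulo \<open>p\<close>, also when an
  intermediate cancellation occurs. Associativity of the product rests on this.\<close>

lemma cp_cons_cp_cons:
  assumes "cp_reduced p w"
  shows "cp_cons p (b, k) (cp_cons p (b, l) w) = cp_cons p (b, k + l) w"
proof (cases "w = [] \<or> fst (hd w) \<noteq> b")
  case True
  then have *: "cp_cons p (b, j) w = (if j mod p = 0 then w else (b, j mod p) # w)" for j
    by (cases w) auto
  show ?thesis
  proof (cases "l mod p = 0")
    case True
    then have "(k + l) mod p = k mod p"
      by (metis add.right_neutral mod_add_right_eq)
    with True show ?thesis by (simp add: *)
  qed (auto simp: * mod_simps)
next
  case False
  then obtain m v where w: "w = (b, m) # v"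
    by (cases w) auto
  have v: "cp_reduced p v" "v = [] \<or> fst (hd v) \<noteq> b" and m: "0 < m" "m < p"
    using assms w by (auto simp: cp_reduced_Cons)
  \<comment> \<open>If \<open>l\<close> cancels the first letter of \<open>w\<close>, then
    \<open>v\<close> is exposed. It does not begin in the factor \<open>b\<close>, because
    \<open>w\<close> is reduced, so the next letter is simply put in front.\<close>
  have *: "cp_cons p (b, j) v = (if j mod p = 0 then v else (b, j mod p) # v)" for j
    using v(2) by (cases v) auto
  show ?thesis
  proof (cases "(l + m) mod p = 0")
    case True
    then have "(k + l + m) mod p = k mod p"
      by (metis add.right_neutral group_cancel.add1 mod_add_right_eq)
    with True show ?thesis by (simp add: w *)
  next
    case False
    have "(k + (l + m) mod p) mod p = (k + l + m) mod p"
      by (simp add: mod_simps add.assoc)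
    with False show ?thesis by (simp add: w)
  qed
qed

section \<open>The group of reduced words\<close>

locale cp_words =
  fixes p :: nat
  assumes p_gt_1: "1 < p"
begin

lemma cp_cons_reduced: "cp_reduced p w \<Longrightarrow> cp_reduced p (cp_cons p l w)"
  using p_gt_1 by (cases l; cases w) (auto simp: cp_reduced_Cons split: if_splits)

lemma cp_mult_Nil [simp]: "cp_mult p [] v = v"
  and cp_mult_Cons: "cp_mult p (l # u) v = cp_cons p l (cp_mult p u v)"
  by (simp_all add: cp_mult_def)

lemma cp_mult_reduced: "cp_reduced p v \<Longrightarrow> cp_reduced p (cp_mult p u v)"
  by (induction u) (auto simp: cp_mult_Cons cp_cons_reduced)

text \<open>Associativity with a single letter as leftmost factor; the general case follows by
  induction on the word.\<close>

lemma cp_mult_cp_cons: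
  assumes "cp_reduced p u" "cp_reduced p v"
  shows "cp_mult p (cp_cons p l u) v = cp_cons p l (cp_mult p u v)"
proof (cases l)
  case (Pair b k)
  note red = cp_mult_reduced[OF assms(2)]
  show ?thesis
  proof (cases "u = [] \<or> fst (hd u) \<noteq> b")
    case True
    then have "cp_cons p l u = (if k mod p = 0 then u else (b, k mod p) # u)"
      using Pair by (cases u) auto
    then show ?thesis
      using Pair red by (auto simp: cp_mult_Cons cp_cons_zero cp_cons_mod)
  next
    case False
    then obtain m w where u: "u = (b, m) # w"
      by (cases u) auto
    then show ?thesis
      using Pair red by (auto simp: cp_mult_Cons cp_cons_cp_cons cp_cons_zero cp_cons_mod)
  qed
qed

lemma cp_mult_assoc:
  assumes "cp_reduced p u" "cp_reduced p v" "cp_reduced p w"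
  shows "cp_mult p (cp_mult p u v) w = cp_mult p u (cp_mult p v w)"
  using assms(1)
proof (induction u)
  case (Cons l u)
  then have "cp_reduced p u"
    by (simp add: cp_reduced_Cons)
  with Cons assms show ?case
    by (simp add: cp_mult_Cons cp_mult_cp_cons cp_mult_reduced)
qed simp

lemma cp_mult_append:
  "cp_reduced p (u @ v) \<Longrightarrow> cp_mult p u v = u @ v"
  by (induction u) (auto simp: cp_mult_Cons cp_cons_eq_Cons cp_reduced_Cons)

definition cp_inv :: "(bool \<times> nat) list \<Rightarrow> (bool \<times> nat) list" where
  "cp_inv w = rev (map (\<lambda>(b, k). (b, p - k)) w)"

lemma cp_reduced_cp_inv:
  assumes "cp_reduced p w" shows "cp_reduced p (cp_inv w)"
proof -
  have "map fst (cp_inv w) = rev (map fst w)"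
    by (simp add: cp_inv_def rev_map case_prod_unfold comp_def)
  with assms show ?thesis
    unfolding cp_reduced_iff by (auto simp: cp_inv_def)
qed

lemma cp_mult_cp_inv:
  assumes "cp_reduced p w" shows "cp_mult p (cp_inv w) w = []"
  using assms
proof (induction w)
  case (Cons l w)
  obtain b k where l: "l = (b, k)" by (cases l)
  have w: "cp_reduced p w" and k: "0 < k" "k < p"
    using Cons.prems by (auto simp: l cp_reduced_Cons)
  have "cp_mult p (cp_inv (l # w)) (l # w) = cp_mult p (cp_inv w) (cp_cons p (b, p - k) (l # w))"
    by (simp add: cp_inv_def l cp_mult_def)
  also have "\<dots> = cp_mult p (cp_inv w) w"
    using k by (simp add: l)
  finally show ?case
    using Cons.IH w by simp
qed (simp add: cp_inv_def)

abbreviation F where "F \<equiv> CpCp p"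

lemma carrier_F: "w \<in> carrier F \<longleftrightarrow> cp_reduced p w"
  and mult_F: "u \<otimes>\<^bsub>F\<^esub> v = cp_mult p u v"
  and one_F: "\<one>\<^bsub>F\<^esub> = []"
  by (simp_all add: CpCp_def)

sublocale F: group F
proof (rule groupI)
  show "\<exists>y\<in>carrier F. y \<otimes>\<^bsub>F\<^esub> x = \<one>\<^bsub>F\<^esub>" if "x \<in> carrier F" for x
    using that cp_mult_cp_inv cp_reduced_cp_inv carrier_F mult_F one_F by metis
qed (auto simp: carrier_F mult_F one_F cp_mult_reduced cp_mult_assoc)

lemma inv_F: "w \<in> carrier F \<Longrightarrow> inv\<^bsub>F\<^esub> w = cp_inv w"
  by (rule F.inv_equality) (auto simp: carrier_F mult_F one_F cp_mult_cp_inv cp_reduced_cp_inv)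

text \<open>Powers of the generators with arbitrary exponents. Multiples of \<open>p\<close> must
  give the empty word, as reduced words carry no exponent 0; with this convention
  \<open>syl b\<close> is additive without side conditions.\<close>

definition syl :: "bool \<Rightarrow> nat \<Rightarrow> (bool \<times> nat) list" where
  "syl b k = (if k mod p = 0 then [] else [(b, k mod p)])"

lemma syl_in [simp, intro]: "syl b k \<in> carrier F"
  using p_gt_1 by (auto simp: syl_def carrier_F)

lemma syl_mult: "w \<in> carrier F \<Longrightarrow> syl b k \<otimes>\<^bsub>F\<^esub> w = cp_cons p (b, k) w"
  by (auto simp: syl_def mult_F carrier_F cp_mult_Cons cp_cons_mod cp_cons_zero)

lemma syl_add: "syl b k \<otimes>\<^bsub>F\<^esub> syl b l = syl b (k + l)"
proof -
  have s: "cp_cons p (b, j) [] = syl b j" for j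
    by (simp add: syl_def)
  have "syl b k \<otimes>\<^bsub>F\<^esub> syl b l = cp_cons p (b, k) (cp_cons p (b, l) [])"
    by (simp only: syl_mult[OF syl_in] s)
  also have "\<dots> = syl b (k + l)"
    by (subst cp_cons_cp_cons) (simp_all only: cp_reduced.simps s)
  finally show ?thesis .
qed

lemma syl_0 [simp]: "syl b 0 = \<one>\<^bsub>F\<^esub>" and syl_p [simp]: "syl b p = \<one>\<^bsub>F\<^esub>"
  by (simp_all add: syl_def one_F)

lemma syl_pow: "syl b k [^]\<^bsub>F\<^esub> (n::nat) = syl b (n * k)"
  by (induction n) (auto simp: syl_add add.commute)

lemma syl_inv: "k \<le> p \<Longrightarrow> inv\<^bsub>F\<^esub> (syl b k) = syl b (p - k)"
  by (rule F.inv_equality) (auto simp: syl_add)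

lemma syl_single: "0 < k \<Longrightarrow> k < p \<Longrightarrow> syl b k = [(b, k)]"
  by (simp add: syl_def)

lemma F_append:
  assumes "u @ v \<in> carrier F"
  shows "u @ v = u \<otimes>\<^bsub>F\<^esub> v" "u \<in> carrier F" "v \<in> carrier F"
  using assms by (auto simp: carrier_F mult_F cp_mult_append cp_reduced_append)

lemma F_Cons:
  assumes "(b, k) # w \<in> carrier F"
  shows "(b, k) # w = syl b k \<otimes>\<^bsub>F\<^esub> w" "w \<in> carrier F" "0 < k" "k < p"
  using assms F_append[of "[(b, k)]" w] syl_single[of k b]
  by (auto simp: carrier_F cp_reduced_Cons)

lemma generate_F: "generate F {syl False (Suc 0), syl True (Suc 0)} = carrier F"
proof
  show "generate F {syl False (Suc 0), syl True (Suc 0)} \<subseteq> carrier F"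
    by (rule F.generate_incl) auto
  interpret S: subgroup "generate F {syl False (Suc 0), syl True (Suc 0)}" F
    by (rule F.generate_is_subgroup) auto
  have "syl b (Suc 0) \<in> generate F {syl False (Suc 0), syl True (Suc 0)}" for b
    by (cases b) (auto intro: generate.incl)
  then have *: "syl b k \<in> generate F {syl False (Suc 0), syl True (Suc 0)}" for b k
    using F.subgroup_int_pow_closed[OF S.subgroup_axioms, of "syl b (Suc 0)" "int k"]
    by (simp add: syl_pow int_pow_int)
  show "carrier F \<subseteq> generate F {syl False (Suc 0), syl True (Suc 0)}"
  proof
    fix w assume "w \<in> carrier F"
    then show "w \<in> generate F {syl False (Suc 0), syl True (Suc 0)}"
    proof (induction w)
      case Nil
      then show ?case using S.one_closed by (simp add: one_F)
    next
      case (Cons l w)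
      then show ?case
        using F_Cons[of "fst l" "snd l" w] * S.m_closed by (metis prod.collapse)
    qed
  qed
qed

text \<open>The exponent sums modulo \<open>p\<close> are the two coordinates of the abelianization.\<close>

definition esum :: "bool \<Rightarrow> (bool \<times> nat) list \<Rightarrow> nat" where
  "esum b w = (\<Sum>l\<leftarrow>w. if fst l = b then snd l else 0)"

lemma esum_cp_cons: "esum b (cp_cons p l w) mod p = (esum b [l] + esum b w) mod p"
proof (cases l)
  case (Pair c k)
  have 0: "(k + n) mod p = n mod p" if "k mod p = 0" for n k
    using that by (metis add_0 mod_add_left_eq)
  show ?thesis
  proof (cases w)
    case (Cons l' v)
    obtain d m where "l' = (d, m)" by (cases l')
    with Cons Pair show ?thesis
      using 0[of "k + m" "esum b v"] 0[of k "m + esum b v"] 0[of k "esum b v"]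
      by (auto simp: esum_def mod_simps add.assoc)
  qed (use Pair in \<open>auto simp: esum_def mod_simps\<close>)
qed

lemma esum_mult: "esum b (u \<otimes>\<^bsub>F\<^esub> v) mod p = (esum b u + esum b v) mod p"
proof (induction u)
  case (Cons l u)
  have "esum b ((l # u) \<otimes>\<^bsub>F\<^esub> v) mod p = (esum b [l] + esum b (u \<otimes>\<^bsub>F\<^esub> v)) mod p"
    by (simp add: mult_F cp_mult_Cons esum_cp_cons)
  also have "\<dots> = (esum b [l] + (esum b u + esum b v)) mod p"
    using Cons by (metis mod_add_right_eq)
  finally show ?case
    by (simp add: esum_def add.assoc)
qed (simp add: mult_F esum_def)

lemma esum_one [simp]: "esum b \<one>\<^bsub>F\<^esub> = 0"
  by (simp add: esum_def one_F)

lemma esum_syl: "esum b (syl c k) mod p = (if b = c then k mod p else 0)"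
  by (simp add: esum_def syl_def)

lemma esum_hom: "(\<lambda>w. int (esum b w mod p)) \<in> hom F (integer_mod_group p)"
  using p_gt_1
  by (intro homI) (auto simp: carrier_integer_mod_group esum_mult mult_integer_mod_group mod_simps
      simp flip: of_nat_mod of_nat_add)

end

section \<open>Cancellation and torsion in the free product\<close>

context cp_words
begin

text \<open>Words of this shape can be joined by, or surrounded with, nontrivial syllables of the
  other factor without any cancellation.\<close>

definition framed :: "bool \<Rightarrow> (bool \<times> nat) list \<Rightarrow> bool" where
  "framed c w \<longleftrightarrow> w \<in> carrier F \<and> w \<noteq> [] \<and> fst (hd w) = c \<and> fst (last w) = c"

text \<open>Copies of such a word can be concatenated without cancellation, so the word has infinite
  order.\<close>

definition mixed :: "bool \<Rightarrow> (bool \<times> nat) list \<Rightarrow> bool" where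
  "mixed c w \<longleftrightarrow> w \<in> carrier F \<and> w \<noteq> [] \<and> fst (hd w) = c \<and> fst (last w) \<noteq> c"

lemma framed_in: "framed c u \<Longrightarrow> u \<in> carrier F"
  by (simp add: framed_def)

lemma syl_neq:
  assumes "k mod p \<noteq> 0"
  shows "syl d k = [(d, k mod p)]" "0 < k mod p" "k mod p < p"
  using assms p_gt_1 by (auto simp: syl_def)

lemma framed_mult:
  assumes "framed c u" "framed c v" "e mod p \<noteq> 0" "d \<noteq> c"
  shows "framed c (u \<otimes>\<^bsub>F\<^esub> syl d e \<otimes>\<^bsub>F\<^esub> v)"
proof -
  have "cp_reduced p (u @ syl d e @ v)"
    using assms syl_neq(1)[OF assms(3), of d] syl_neq(2,3)[OF assms(3)]
    by (auto simp: framed_def cp_reduced_append cp_reduced_Cons carrier_F)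
  then have "u \<otimes>\<^bsub>F\<^esub> syl d e \<otimes>\<^bsub>F\<^esub> v = u @ syl d e @ v" and "u @ syl d e @ v \<in> carrier F"
    using F_append[of u "syl d e @ v"] F_append[of "syl d e" v]
    by (auto simp: carrier_F F.m_assoc)
  with assms show ?thesis
    by (auto simp: framed_def)
qed

lemma framed_Cons_snoc:
  assumes "framed d s" "c \<noteq> d" "0 < j" "j < p" "0 < k" "k < p"
  shows "framed c (syl c j \<otimes>\<^bsub>F\<^esub> s \<otimes>\<^bsub>F\<^esub> syl c k)"
proof -
  have "cp_reduced p ([(c, j)] @ s @ [(c, k)])"
    using assms by (auto simp: framed_def cp_reduced_append cp_reduced_Cons carrier_F)
  then have "syl c j \<otimes>\<^bsub>F\<^esub> s \<otimes>\<^bsub>F\<^esub> syl c k = [(c, j)] @ s @ [(c, k)]"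
    and "[(c, j)] @ s @ [(c, k)] \<in> carrier F"
    using F_append[of "[(c, j)]" "s @ [(c, k)]"] F_append[of s "[(c, k)]"] assms
    by (auto simp: carrier_F F.m_assoc syl_single)
  then show ?thesis
    by (auto simp: framed_def)
qed

lemma framed_inv:
  assumes "framed c u" shows "framed c (inv\<^bsub>F\<^esub> u)"
proof -
  have "inv\<^bsub>F\<^esub> u = cp_inv u" "cp_inv u \<in> carrier F"
    using assms by (auto simp: inv_F framed_def carrier_F cp_reduced_cp_inv)
  then show ?thesis
    using assms
    by (auto simp: framed_def cp_inv_def hd_rev last_rev last_map hd_map case_prod_unfold)
qed

text \<open>Removing the two outer letters leaves a word framed by the other factor. It is nonempty
  because two letters from the factor \<open>c\<close> cannot be adjacent. This drives the
  inductions on length below.\<close>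

lemma framed_cases:
  assumes "framed c u"
  obtains (single) k where "0 < k" "k < p" "u = syl c k"
  | (long) j s k where "u = (c, j) # s @ [(c, k)]" "framed (\<not> c) s" "0 < j" "j < p" "0 < k" "k < p"
      "u = syl c j \<otimes>\<^bsub>F\<^esub> s \<otimes>\<^bsub>F\<^esub> syl c k"
proof -
  obtain l v where u: "u = l # v"
    using assms by (cases u) (auto simp: framed_def)
  show thesis
  proof (cases v rule: rev_cases)
    case Nil
    then show thesis
      using assms u single[of "snd l"] by (cases l) (auto simp: framed_def carrier_F syl_single)
  next
    case (snoc s m)
    obtain j k where l: "l = (c, j)" "m = (c, k)"
      using assms u snoc by (cases l; cases m) (auto simp: framed_def)
    have red: "cp_reduced p ([(c, j)] @ s @ [(c, k)])"
      using assms u snoc l by (auto simp: framed_def carrier_F)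
    then have "s \<noteq> []"
      by (auto simp: cp_reduced_Cons)
    with red have "framed (\<not> c) s" and jk: "0 < j" "j < p" "0 < k" "k < p"
      by (auto simp: framed_def cp_reduced_append cp_reduced_Cons carrier_F)
    moreover have "u = syl c j \<otimes>\<^bsub>F\<^esub> s \<otimes>\<^bsub>F\<^esub> syl c k"
      using F_append[of "[(c, j)]" "s @ [(c, k)]"] F_append[of s "[(c, k)]"] red jk u snoc l
      by (auto simp: carrier_F F.m_assoc syl_single)
    ultimately show thesis
      using long u snoc l by simp
  qed
qed

text \<open>The inner letters \<open>k\<close> and \<open>j\<close> meet in the middle. If they do
  not cancel, a nontrivial syllable separates two copies of \<open>s\<close>; if they do, the
  induction hypothesis treats the square of \<open>s\<close>. For a single syllable the exponent
  doubles and stays nonzero modulo the odd \<open>p\<close>.\<close>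

lemma framed_square:
  assumes "odd p" "framed c u"
  shows "framed c (u \<otimes>\<^bsub>F\<^esub> u)"
  using assms(2)
proof (induction "length u" arbitrary: u c rule: less_induct)
  case less
  from less.prems show ?case
  proof (cases rule: framed_cases)
    case (single k)
    have "(k + k) mod p \<noteq> 0"
    proof
      assume "(k + k) mod p = 0"
      then have "p dvd 2 * k"
        by (simp add: mult_2 mod_eq_0_iff_dvd)
      then have "p dvd k"
        using \<open>odd p\<close> by (simp add: coprime_dvd_mult_right_iff)
      with single show False by (auto dest: dvd_imp_le)
    qed
    from syl_neq(1)[OF this, of c] show ?thesis
      using syl_in[of c "k + k"] by (auto simp: framed_def single syl_add)
  next
    case (long j s k)
    have s: "s \<in> carrier F"
      using long framed_in by blast
    have "u \<otimes>\<^bsub>F\<^esub> u = syl c j \<otimes>\<^bsub>F\<^esub> (s \<otimes>\<^bsub>F\<^esub> syl c (k + j) \<otimes>\<^bsub>F\<^esub> s) \<otimes>\<^bsub>F\<^esub> syl c k"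
      using s by (simp add: long(7) F.m_assoc flip: syl_add)
    moreover have "framed (\<not> c) (s \<otimes>\<^bsub>F\<^esub> syl c (k + j) \<otimes>\<^bsub>F\<^esub> s)"
    proof (cases "(k + j) mod p = 0")
      case True
      then have "s \<otimes>\<^bsub>F\<^esub> syl c (k + j) \<otimes>\<^bsub>F\<^esub> s = s \<otimes>\<^bsub>F\<^esub> s"
        using s by (simp add: syl_def flip: one_F)
      then show ?thesis
        using less.hyps[of s "\<not> c"] long by simp
    qed (use framed_mult[of "\<not> c" s s "k + j" c] long(2) in simp)
    ultimately show ?thesis
      using framed_Cons_snoc[of "\<not> c" _ c j k] long(3-6) by simp
  qed
qed

lemma mixed_pow:
  assumes "mixed c w" shows "mixed c (w [^]\<^bsub>F\<^esub> Suc n)"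
proof (induction n)
  case (Suc n)
  let ?v = "w [^]\<^bsub>F\<^esub> Suc n"
  have "cp_reduced p (?v @ w)"
    using assms Suc by (auto simp: mixed_def carrier_F cp_reduced_append)
  then have "w [^]\<^bsub>F\<^esub> Suc (Suc n) = ?v @ w" "?v @ w \<in> carrier F"
    using F_append[of ?v w] by (auto simp: carrier_F)
  with Suc assms show ?case
    unfolding mixed_def by (metis append_is_Nil_conv hd_append2 last_appendR)
qed (use assms in \<open>auto simp: mixed_def\<close>)

lemma mixed_pow_neq_one:
  "mixed c w \<Longrightarrow> 0 < n \<Longrightarrow> w [^]\<^bsub>F\<^esub> (n::nat) \<noteq> \<one>\<^bsub>F\<^esub>"
  using mixed_pow[of c w "n - 1"] by (auto simp: mixed_def one_F)

lemma strip_hd: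
  assumes "w \<in> carrier F" "c \<noteq> d"
  obtains a v where "w = syl d a \<otimes>\<^bsub>F\<^esub> v" "v \<in> carrier F" "v = [] \<or> fst (hd v) = c"
proof (cases "w = [] \<or> fst (hd w) = c")
  case True
  then show thesis
    using that[of 0 w] assms by simp
next
  case False
  then obtain k v where w: "w = (d, k) # v"
    using assms(2) by (cases w) auto
  then have "v = [] \<or> fst (hd v) = c"
    using assms by (auto simp: carrier_F cp_reduced_Cons)
  then show thesis
    using that F_Cons assms(1) w by blast
qed

text \<open>Syllables of the factor \<open>d\<close> are stripped from both ends; what remains is
  nonempty because \<open>w\<close> is not in that factor. The exponents \<open>a\<close> and
  \<open>b\<close> may be 0, where \<open>syl\<close> is trivial.\<close>

lemma framed_decomp:
  assumes "w \<in> carrier F" "c \<noteq> d" "\<And>k. w \<noteq> syl d k"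
  obtains a u b where "framed c u" "w = syl d a \<otimes>\<^bsub>F\<^esub> u \<otimes>\<^bsub>F\<^esub> syl d b"
proof -
  obtain a v where v: "w = syl d a \<otimes>\<^bsub>F\<^esub> v" "v \<in> carrier F" "v = [] \<or> fst (hd v) = c"
    using strip_hd[OF assms(1,2)] .
  then have "v \<noteq> []"
    using assms(3)[of a] F.r_one[of "syl d a"] by (auto simp: one_F)
  with v have hd: "fst (hd v) = c"
    by simp
  obtain s l where s: "v = s @ [l]"
    using \<open>v \<noteq> []\<close> by (cases v rule: rev_cases) auto
  show thesis
  proof (cases "fst l = c")
    case True
    then have "framed c v"
      using v(2) s hd by (simp add: framed_def)
    then show thesis
      using that[of v a 0] v(1,2) by simp
  next
    case False
    then have "l = (d, snd l)"
      using assms(2) by (auto intro: prod_eqI)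
    then obtain k where l: "l = (d, k)" ..
    have "s \<noteq> []"
      using hd s False by auto
    have red: "cp_reduced p (s @ [(d, k)])"
      using v s l by (simp add: carrier_F)
    then have "framed c s"
      using \<open>s \<noteq> []\<close> s hd assms(2) by (cases c; cases d) (auto simp: framed_def carrier_F cp_reduced_append)
    moreover have "v = s \<otimes>\<^bsub>F\<^esub> syl d k"
      using F_append(1)[of s "[(d, k)]"] s l red
      by (simp add: carrier_F cp_reduced_append syl_single)
    ultimately show thesis
      using that[of s a k] v(1) by (simp add: F.m_assoc framed_in)
  qed
qed

text \<open>Mixed words have infinite order, so \<open>x\<close> is framed. If it is longer than one
  syllable, conjugation moves its first letter to the end, where it merges with the last one and
  shortens the word. The induction ends at a single syllable.\<close>

lemma torsion_conj_syl:
  assumes "x \<in> carrier F" "x \<noteq> \<one>\<^bsub>F\<^esub>" "x [^]\<^bsub>F\<^esub> p = \<one>\<^bsub>F\<^esub>"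
  shows "\<exists>g b i. g \<in> carrier F \<and> 0 < i \<and> i < p \<and> x = g \<otimes>\<^bsub>F\<^esub> syl b i \<otimes>\<^bsub>F\<^esub> inv\<^bsub>F\<^esub> g"
  using assms
proof (induction "length x" arbitrary: x rule: less_induct)
  case less
  define c where "c = fst (hd x)"
  have "\<not> mixed c x"
    using mixed_pow_neq_one less.prems p_gt_1 by fastforce
  then have "framed c x"
    using less.prems by (auto simp: mixed_def framed_def c_def one_F)
  then show ?case
  proof (cases rule: framed_cases)
    case (single k)
    then have "x = \<one>\<^bsub>F\<^esub> \<otimes>\<^bsub>F\<^esub> syl c k \<otimes>\<^bsub>F\<^esub> inv\<^bsub>F\<^esub> \<one>\<^bsub>F\<^esub>"
      by simp
    with single show ?thesis
      using F.one_closed by blast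
  next
    case (long j s k)
    have s: "s \<in> carrier F"
      using long framed_in by blast
    define y where "y = s \<otimes>\<^bsub>F\<^esub> syl c (k + j)"
    have y: "y \<in> carrier F"
      using s by (simp add: y_def)
    have x: "x = syl c j \<otimes>\<^bsub>F\<^esub> y \<otimes>\<^bsub>F\<^esub> inv\<^bsub>F\<^esub> (syl c j)"
      using s by (simp add: long(7) y_def F.m_assoc flip: syl_add)
    have "cp_reduced p (s @ syl c (k + j))"
      using long(2) p_gt_1 by (auto simp: framed_def carrier_F cp_reduced_append syl_def)
    then have "y = s @ syl c (k + j)"
      using F_append(1)[of s "syl c (k + j)"] by (simp add: carrier_F y_def)
    then have "length y < length x"
      by (simp add: long(1) syl_def)
    moreover have "y \<noteq> \<one>\<^bsub>F\<^esub>" "y [^]\<^bsub>F\<^esub> p = \<one>\<^bsub>F\<^esub>"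
      using less.prems(2,3) y by (simp_all add: x F.pow_conj F.conj_eq_one)
    ultimately obtain g b i where g: "g \<in> carrier F" "0 < i" "i < p"
      "y = g \<otimes>\<^bsub>F\<^esub> syl b i \<otimes>\<^bsub>F\<^esub> inv\<^bsub>F\<^esub> g"
      using less.hyps y by blast
    have "x = (syl c j \<otimes>\<^bsub>F\<^esub> g) \<otimes>\<^bsub>F\<^esub> syl b i \<otimes>\<^bsub>F\<^esub> inv\<^bsub>F\<^esub> (syl c j \<otimes>\<^bsub>F\<^esub> g)"
      unfolding x g(4) using g(1) by (simp add: F.m_assoc F.inv_mult_group)
    with g show ?thesis
      using F.m_closed[OF syl_in[of c j] g(1)] by blast
  qed
qed

text \<open>Otherwise \<open>b\<close> is a framed word \<open>u\<close> between syllables with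
  exponents \<open>a\<close> and \<open>e\<close> of the factor \<open>d\<close>. Since syllables of
  one factor commute, \<open>rel (syl d i) b\<close> is conjugate to the product of
  \<open>u\<close>, \<open>syl d (e + a)\<close>, \<open>u\<close>, \<open>syl d i\<close>,
  \<open>inv u\<close> and \<open>syl d (p - i)\<close>. The first three form a framed word
  \<open>v\<close>, by \<open>framed_square\<close> if the middle syllable vanishes. The whole word
  is then mixed and cannot be torsion.\<close>

lemma rel_syl_torsion:
  assumes "odd p" "0 < i" "i < p" "b \<in> carrier F" "F.rel (syl d i) b [^]\<^bsub>F\<^esub> p = \<one>\<^bsub>F\<^esub>"
  shows "\<exists>k. b = syl d k"
proof (rule ccontr)
  assume "\<nexists>k. b = syl d k"
  then have ne: "b \<noteq> syl d k" for k
    by blast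
  have nd: "(\<not> d) \<noteq> d"
    by simp
  obtain a u e where u: "framed (\<not> d) u" and b: "b = syl d a \<otimes>\<^bsub>F\<^esub> u \<otimes>\<^bsub>F\<^esub> syl d e"
    by (rule framed_decomp[OF assms(4) nd ne]) blast
  have [simp]: "u \<in> carrier F"
    using u framed_in by blast
  define v where "v = u \<otimes>\<^bsub>F\<^esub> syl d (e + a) \<otimes>\<^bsub>F\<^esub> u"
  define w where "w = v \<otimes>\<^bsub>F\<^esub> syl d i \<otimes>\<^bsub>F\<^esub> inv\<^bsub>F\<^esub> u"
  have [simp]: "v \<in> carrier F" "w \<in> carrier F"
    by (auto simp: v_def w_def)
  have "framed (\<not> d) v"
  proof (cases "(e + a) mod p = 0")
    case True
    then have "v = u \<otimes>\<^bsub>F\<^esub> u"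
      by (simp add: v_def syl_def flip: one_F)
    with framed_square[OF assms(1) u] show ?thesis by simp
  qed (use framed_mult[OF u u, of "e + a" d] in \<open>simp add: v_def\<close>)
  then have w: "framed (\<not> d) w"
    using framed_mult[OF _ framed_inv[OF u], of v i d] assms(2,3) by (simp add: w_def)
  then have "cp_reduced p (w @ syl d (p - i))"
    using assms(2,3) by (auto simp: framed_def carrier_F cp_reduced_append syl_def)
  then have "w \<otimes>\<^bsub>F\<^esub> syl d (p - i) = w @ syl d (p - i)" "w @ syl d (p - i) \<in> carrier F"
    using F_append[of w "syl d (p - i)"] by (auto simp: carrier_F)
  then have "mixed (\<not> d) (w \<otimes>\<^bsub>F\<^esub> syl d (p - i))"
    using w assms(2,3) by (auto simp: framed_def mixed_def syl_def)
  then have "(w \<otimes>\<^bsub>F\<^esub> syl d (p - i)) [^]\<^bsub>F\<^esub> p \<noteq> \<one>\<^bsub>F\<^esub>"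
    using mixed_pow_neq_one[of "\<not> d" _ p] p_gt_1 by simp
  moreover have "F.rel (syl d i) b =
    syl d a \<otimes>\<^bsub>F\<^esub> (w \<otimes>\<^bsub>F\<^esub> syl d (p - i)) \<otimes>\<^bsub>F\<^esub> inv\<^bsub>F\<^esub> (syl d a)"
  proof -
    have comm: "syl d j \<otimes>\<^bsub>F\<^esub> syl d k = syl d k \<otimes>\<^bsub>F\<^esub> syl d j" for j k
      by (simp add: syl_add add.commute)
    have 1: "syl d e \<otimes>\<^bsub>F\<^esub> (syl d i \<otimes>\<^bsub>F\<^esub> (inv\<^bsub>F\<^esub> (syl d e) \<otimes>\<^bsub>F\<^esub> z)) = syl d i \<otimes>\<^bsub>F\<^esub> z"
      if "z \<in> carrier F" for z
      using that comm[of e i] by (simp flip: F.m_assoc) (simp add: F.m_assoc)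
    have 2: "inv\<^bsub>F\<^esub> (syl d a) \<otimes>\<^bsub>F\<^esub> inv\<^bsub>F\<^esub> (syl d i) = inv\<^bsub>F\<^esub> (syl d i) \<otimes>\<^bsub>F\<^esub> inv\<^bsub>F\<^esub> (syl d a)"
      using comm[of a i] by (simp flip: F.inv_mult_group)
    show ?thesis
      using assms(2,3)
      by (simp add: F.rel_def b v_def w_def F.m_assoc F.inv_mult_group 1 2 flip: syl_add syl_inv)
  qed
  ultimately show False
    using assms(5) by (simp add: F.pow_conj F.conj_eq_one)
qed

text \<open>Conjugation takes \<open>x\<close> to a syllable and commutes with \<open>rel\<close>,
  which reduces the claim to \<open>rel_syl_torsion\<close>. This is the property of
  \<open>F\<close> that the two constructed groups violate.\<close>

lemma rel_torsion:
  assumes "Factorial_Ring.prime p" "odd p"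
    and "x \<in> carrier F" "x \<noteq> \<one>\<^bsub>F\<^esub>" "x [^]\<^bsub>F\<^esub> p = \<one>\<^bsub>F\<^esub>"
    and "b \<in> carrier F" "F.rel x b [^]\<^bsub>F\<^esub> p = \<one>\<^bsub>F\<^esub>"
  shows "\<exists>k::nat. b = x [^]\<^bsub>F\<^esub> k"
proof -
  obtain g d i where g: "g \<in> carrier F" and i: "0 < i" "i < p"
    and x: "x = g \<otimes>\<^bsub>F\<^esub> syl d i \<otimes>\<^bsub>F\<^esub> inv\<^bsub>F\<^esub> g"
    using torsion_conj_syl assms by blast
  define a where "a = inv\<^bsub>F\<^esub> g \<otimes>\<^bsub>F\<^esub> b \<otimes>\<^bsub>F\<^esub> g"
  have a: "a \<in> carrier F" and b: "b = g \<otimes>\<^bsub>F\<^esub> a \<otimes>\<^bsub>F\<^esub> inv\<^bsub>F\<^esub> g"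
    using g assms(6) by (auto simp: a_def F.m_assoc)
  have "F.rel (syl d i) a [^]\<^bsub>F\<^esub> p = \<one>\<^bsub>F\<^esub>"
    using assms(7) g a unfolding x b by (simp add: F.rel_conj F.pow_conj F.conj_eq_one)
  then obtain k where k: "a = syl d k"
    using rel_syl_torsion assms(2) i a by blast
  \<comment> \<open>Since \<open>p\<close> is prime, \<open>i\<close> is invertible modulo
    \<open>p\<close>, so every syllable of the factor \<open>d\<close> is a power of
    \<open>syl d i\<close>.\<close>
  have "coprime i p"
    using assms(1) i prime_imp_coprime[of p i] by (metis coprime_commute nat_dvd_not_less)
  then obtain s where "[i * s = 1] (mod p)"
    using cong_solve_coprime_nat[of i p] by auto
  then obtain t where "[i * t = k] (mod p)"
    using cong_scalar_right[of "i * s" 1 p k] by (auto simp: mult.assoc)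
  then have "syl d (t * i) = syl d k"
    by (simp add: syl_def cong_def mult.commute)
  then have "b = x [^]\<^bsub>F\<^esub> t"
    using g unfolding b x by (simp add: F.pow_conj syl_pow k)
  then show ?thesis ..
qed

end

section \<open>Abelianization, rank and countable groups\<close>

lemma (in comm_group) lower_central_Suc_Suc: "lower_central G (Suc (Suc k)) = {\<one>}"
proof -
  have "x \<otimes> y \<otimes> inv x \<otimes> inv y = \<one>" if "x \<in> carrier G" "y \<in> carrier G" for x y
    using that by (simp add: m_comm[of x y] m_assoc)
  then have "commutator_set G (carrier G) (lower_central G (Suc k)) \<subseteq> {\<one>}"
    using lower_central_subset[of "Suc k"] by (auto simp: commutator_set_def)
  then have "generate G (commutator_set G (carrier G) (lower_central G (Suc k))) \<subseteq> generate G {\<one>}"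
    by (rule mono_generate)
  then show ?thesis
    unfolding lower_central.simps generate_one using generate.one[of G] by fast
qed

text \<open>Every generated element is the product of a finite list of generators and inverses of
  generators, and there are countably many such lists.\<close>

lemma (in group) countable_generate:
  assumes "countable S" "S \<subseteq> carrier G" shows "countable (generate G S)"
proof -
  define T where "T = S \<union> m_inv G ` S"
  have T: "countable T" "T \<subseteq> carrier G"
    using assms by (auto simp: T_def)
  define ev where "ev = (\<lambda>l. foldr (\<otimes>) l \<one>)"
  have ev: "ev l \<in> carrier G" if "set l \<subseteq> carrier G" for l
    using that by (induction l) (auto simp: ev_def)
  have ev_append: "ev (k @ l) = ev k \<otimes> ev l" if "set k \<subseteq> carrier G" "set l \<subseteq> carrier G" for k l
    using that(1)
  proof (induction k)
    case Nil
    then show ?case using ev[OF that(2)] by (simp add: ev_def)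
  next
    case (Cons a k)
    then show ?case
      using ev[OF that(2)] ev[of k] by (simp add: ev_def m_assoc)
  qed
  have "\<exists>l. set l \<subseteq> T \<and> g = ev l" if "g \<in> generate G S" for g
    using that
  proof (induction g rule: generate.induct)
    case one
    show ?case by (rule exI[of _ "[]"]) (simp add: ev_def)
  next
    case (incl h)
    then show ?case
      using assms(2) by (intro exI[of _ "[h]"]) (auto simp: ev_def T_def)
  next
    case (inv h)
    then show ?case
      using assms(2) by (intro exI[of _ "[inv h]"]) (auto simp: ev_def T_def)
  next
    case (eng h1 h2)
    then obtain k l where "set k \<subseteq> T" "h1 = ev k" "set l \<subseteq> T" "h2 = ev l"
      by auto
    then show ?case
      using T(2) ev_append[of k l] by (intro exI[of _ "k @ l"]) auto
  qed
  then have "generate G S \<subseteq> ev ` lists T"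
    by (auto simp: lists_eq_set)
  moreover have "countable (lists T)"
    using T(1) by (rule countable_lists)
  ultimately show ?thesis
    using countable_subset countable_image by metis
qed

text \<open>The theorem asks for groups on \<open>nat\<close>, while the constructions live on
  functions and pairs. The structure is transported along an enumeration of the carrier.\<close>

lemma (in group) countable_iso_nat:
  assumes "countable (carrier G)"
  obtains H :: "nat monoid" and f where "group H" "f \<in> iso G H"
proof
  define f where "f = to_nat_on (carrier G)"
  define g where "g = inv_into (carrier G) f"
  define H where "H = \<lparr>carrier = f ` carrier G, monoid.mult = \<lambda>a b. f (g a \<otimes> g b), one = f \<one>\<rparr>"
  have inj: "inj_on f (carrier G)"
    unfolding f_def using assms by (rule inj_on_to_nat_on)
  have g: "g (f x) = x" if "x \<in> carrier G" for x
    unfolding g_def using inj that by (rule inv_into_f_f)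
  show "group H"
  proof (rule groupI)
    show "\<exists>y\<in>carrier H. y \<otimes>\<^bsub>H\<^esub> x = \<one>\<^bsub>H\<^esub>" if "x \<in> carrier H" for x
      using that by (auto simp: H_def g intro!: bexI[of _ "inv (g x)"])
  qed (auto simp: H_def g m_assoc)
  show "f \<in> iso G H"
    unfolding iso_iff using inj by (auto simp: H_def g hom_def)
qed

section \<open>Exponent sums, rank and the criterion for not being isomorphic to
  \<open>F\<close>\<close>

context cp_words
begin

text \<open>The exponent sum modulo \<open>p\<close> is a homomorphism to an abelian group, whose
  second term is trivial.\<close>

lemma esum_lower_central:
  assumes "w \<in> lower_central F 2" shows "esum b w mod p = 0"
proof -
  interpret Z: comm_group "integer_mod_group p"
    by simp
  have "int (esum b w mod p) \<in> lower_central (integer_mod_group p) 2"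
    using lower_central_hom[OF F.is_group Z.is_group esum_hom] assms by blast
  then show ?thesis
    using Z.lower_central_Suc_Suc[of 0] by (simp add: numeral_2_eq_2)
qed

lemma esum_rcos:
  assumes "u \<in> carrier F" "v \<in> carrier F"
    and "lower_central F 2 #>\<^bsub>F\<^esub> u = lower_central F 2 #>\<^bsub>F\<^esub> v"
  shows "esum b u mod p = esum b v mod p"
proof -
  let ?z = "inv\<^bsub>F\<^esub> u \<otimes>\<^bsub>F\<^esub> v"
  have "esum b ?z mod p = 0"
    using assms F.normal_rcos_eq_iff[OF F.lower_central_normal] esum_lower_central by simp
  moreover have "esum b v mod p = (esum b u + esum b ?z) mod p"
    using assms esum_mult[of b u ?z] by simp
  ultimately show ?thesis
    by (metis add.right_neutral mod_add_right_eq)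
qed

lemma esum_int_pow:
  assumes "w \<in> carrier F"
  shows "int (esum b (w [^]\<^bsub>F\<^esub> (k::int)) mod p) = (k * int (esum b w)) mod int p"
  using hom_int_pow[OF esum_hom assms F.is_group group_integer_mod_group, of b k]
  by (simp add: int_pow_integer_mod_group zmod_int mod_mult_right_eq)

text \<open>If one element generated, the exponent vectors (1, 0) and (0, 1) of the two generators
  of \<open>F\<close> would be multiples, by \<open>k\<close> and \<open>l\<close>, of one vector
  modulo \<open>p\<close>.\<close>

lemma abelianization_not_cyclic:
  assumes "group G" "h \<in> hom G (F Mod lower_central F 2)"
    and "h ` carrier G = carrier (F Mod lower_central F 2)" "g \<in> carrier G"
  shows "generate G {g} \<noteq> carrier G"
proof
  assume gen: "generate G {g} = carrier G"
  interpret G: group G by fact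
  let ?N = "lower_central F 2"
  interpret N: normal ?N F
    by (rule F.lower_central_normal)
  interpret h: group_hom G "F Mod ?N" h
    using assms N.factorgroup_is_group by (simp add: group_hom_def group_hom_axioms_def)
  obtain w where w: "w \<in> carrier F" "h g = ?N #>\<^bsub>F\<^esub> w"
    using h.hom_closed[OF assms(4)] by (auto simp: carrier_FactGroup)
  have ex: "\<exists>k::int. \<forall>b. int (esum b v mod p) = (k * int (esum b w)) mod int p"
    if v: "v \<in> carrier F" for v
  proof -
    have "?N #>\<^bsub>F\<^esub> v \<in> h ` carrier G"
      using v unfolding assms(3) by (simp add: carrier_FactGroup)
    then obtain u where "u \<in> carrier G" "h u = ?N #>\<^bsub>F\<^esub> v"
      by auto
    moreover from this have "u \<in> generate G {g}"
      by (simp add: gen)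
    then obtain k :: int where "u = g [^]\<^bsub>G\<^esub> k"
      unfolding G.generate_pow[OF assms(4)] by auto
    ultimately have "?N #>\<^bsub>F\<^esub> v = ?N #>\<^bsub>F\<^esub> (w [^]\<^bsub>F\<^esub> k)"
      using h.hom_int_pow[OF assms(4), of k] w N.FactGroup_int_pow[OF w(1), of k] by simp
    then show ?thesis
      using esum_rcos[OF v F.int_pow_closed[OF w(1)]] esum_int_pow[OF w(1)] by metis
  qed
  obtain k where k: "int (esum b (syl False (Suc 0)) mod p) = (k * int (esum b w)) mod int p" for b
    using ex[of "syl False (Suc 0)"] by auto
  obtain l where l: "int (esum b (syl True (Suc 0)) mod p) = (l * int (esum b w)) mod int p" for b
    using ex[of "syl True (Suc 0)"] by auto
  let ?s = "int (esum False w)" and ?t = "int (esum True w)"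
  have c: "[k * ?s = 1] (mod int p)" "[k * ?t = 0] (mod int p)"
      "[l * ?s = 0] (mod int p)" "[l * ?t = 1] (mod int p)"
    using k[of False] k[of True] l[of False] l[of True] p_gt_1 by (simp_all add: esum_syl cong_def)
  \<comment> \<open>Both sides are the same product. Grouped in one way it is congruent to 0, in the
    other to 1.\<close>
  have eq: "(k * ?t) * (l * ?s) = (k * ?s) * (l * ?t)"
    by simp
  have "[0 * 0 = 1 * 1] (mod int p)"
    by (rule cong_trans[OF cong_sym[OF cong_mult[OF c(2) c(3), unfolded eq]] cong_mult[OF c(1) c(4)]])
  then show False
    using p_gt_1 by (simp add: cong_def)
qed

text \<open>A generating set with at most one element would make the quotient by the second term
  cyclic, and this quotient agrees with that of \<open>F\<close>.\<close>

lemma group_rank_eq_2: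
  assumes "group G" "a \<in> carrier G" "b \<in> carrier G" "generate G {a, b} = carrier G"
    and "F Mod lower_central F 2 \<cong> G Mod lower_central G 2"
  shows "group_rank G = 2"
proof -
  interpret G: group G by fact
  interpret N: normal "lower_central F 2" F
    by (rule F.lower_central_normal)
  interpret M: normal "lower_central G 2" G
    by (rule G.lower_central_normal)
  obtain f where f: "f \<in> iso (G Mod lower_central G 2) (F Mod lower_central F 2)"
    using group.iso_sym[OF N.factorgroup_is_group assms(5)] by (auto simp: is_iso_def)
  define h where "h = f \<circ> (\<lambda>a. lower_central G 2 #>\<^bsub>G\<^esub> a)"
  have hom: "h \<in> hom G (F Mod lower_central F 2)"
    unfolding h_def using f by (intro hom_compose[OF M.r_coset_hom_Mod]) (simp add: iso_iff)
  have surj: "h ` carrier G = carrier (F Mod lower_central F 2)"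
  proof -
    have "h ` carrier G = f ` carrier (G Mod lower_central G 2)"
      by (simp add: h_def carrier_FactGroup image_comp)
    then show ?thesis
      using f by (simp add: iso_iff)
  qed
  note cyc = abelianization_not_cyclic[OF assms(1) hom surj]
  have *: "2 \<le> card S" if "S \<subseteq> carrier G" "finite S" "generate G S = carrier G" for S
  proof (rule ccontr)
    assume "\<not> 2 \<le> card S"
    then have "card S = 0 \<or> card S = 1"
      by linarith
    then have "S = {} \<or> (\<exists>g. S = {g})"
      using that(2) by (auto simp: card_1_singleton_iff)
    then have "\<exists>g\<in>carrier G. S \<subseteq> {g}"
    proof
      assume "S = {}"
      with G.one_closed show ?thesis by auto
    next
      assume "\<exists>g. S = {g}"
      with that(1) show ?thesis by auto
    qed
    then obtain g where "g \<in> carrier G" "S \<subseteq> {g}" ..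
    then show False
      using cyc[of g] that(3) G.mono_generate[of S "{g}"] G.generate_incl[of "{g}"] by simp
  qed
  \<comment> \<open>The lower bound, applied to the given generators, also excludes
    \<open>a = b\<close>.\<close>
  have "card {a, b} = 2"
    using *[of "{a, b}"] assms card_insert_le_m1[of 2 "{b}" a] by (auto simp: card_insert_if)
  then have "\<exists>S. S \<subseteq> carrier G \<and> finite S \<and> card S = 2 \<and> generate G S = carrier G"
    using assms by (intro exI[of _ "{a, b}"]) auto
  then show ?thesis
    unfolding group_rank_def using * by (intro Least_equality) auto
qed

text \<open>An isomorphism would carry \<open>x\<close> and \<open>b\<close> to elements of
  \<open>F\<close> satisfying \<open>rel_torsion\<close>, and injectivity would make
  \<open>b\<close> a power of \<open>x\<close>.\<close>

lemma not_iso_F: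
  assumes "Factorial_Ring.prime p" "odd p" "group G" "x \<in> carrier G" "b \<in> carrier G"
    and "x \<noteq> \<one>\<^bsub>G\<^esub>" "x [^]\<^bsub>G\<^esub> p = \<one>\<^bsub>G\<^esub>" "group.rel G x b [^]\<^bsub>G\<^esub> p = \<one>\<^bsub>G\<^esub>"
    and "\<And>k::nat. b \<noteq> x [^]\<^bsub>G\<^esub> k"
  shows "\<not> G \<cong> F"
proof
  assume "G \<cong> F"
  then obtain h where h: "h \<in> hom G F" "inj_on h (carrier G)"
    by (auto simp: is_iso_def iso_iff)
  interpret G: group G by fact
  interpret h: group_hom G F h
    using h by (simp add: group_hom_def group_hom_axioms_def F.is_group G.is_group)
  have "h x \<noteq> \<one>\<^bsub>F\<^esub>"
    using assms(4,6) h(2) inj_onD[OF h(2), of x "\<one>\<^bsub>G\<^esub>"] by auto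
  moreover have "h x [^]\<^bsub>F\<^esub> p = \<one>\<^bsub>F\<^esub>"
    using h.hom_nat_pow[OF assms(4), of p] assms(7) by simp
  moreover have "F.rel (h x) (h b) [^]\<^bsub>F\<^esub> p = \<one>\<^bsub>F\<^esub>"
    using h.hom_nat_pow[of "G.rel x b" p] assms(4,5,8) hom_rel[OF G.is_group F.is_group h(1)] by simp
  ultimately obtain k :: nat where "h b = h x [^]\<^bsub>F\<^esub> k"
    using rel_torsion assms(1,2) h.hom_closed assms(4,5) by blast
  then have "h b = h (x [^]\<^bsub>G\<^esub> k)"
    using h.hom_nat_pow[OF assms(4), of k] by simp
  then show False
    using inj_onD[OF h(2)] assms(4,5,9) by auto
qed

lemma transport_to_nat:
  assumes "group G" "a \<in> carrier G" "b \<in> carrier G" "generate G {a, b} = carrier G"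
    and quot: "\<And>i. i \<ge> 1 \<Longrightarrow> F Mod lower_central F i \<cong> G Mod lower_central G i"
    and "\<not> G \<cong> F"
  obtains H :: "nat monoid" where "group H"
    "\<exists>a\<in>carrier H. \<exists>b\<in>carrier H. generate H {a, b} = carrier H" "group_rank H = 2" "\<not> H \<cong> F"
    "\<And>i. i \<ge> 1 \<Longrightarrow> F Mod lower_central F i \<cong> H Mod lower_central H i"
    "residually_nilpotent H \<longleftrightarrow> residually_nilpotent G"
proof -
  interpret G: group G by fact
  have "countable (carrier G)"
    using G.countable_generate[of "{a, b}"] assms by simp
  then obtain H :: "nat monoid" and f where H: "group H" and f: "f \<in> iso G H"
    using G.countable_iso_nat by blast
  interpret f: group_hom G H f
    using H f G.is_group by (simp add: group_hom_def group_hom_axioms_def iso_iff)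
  have gen: "generate H {f a, f b} = carrier H"
    using f.generate_img[of "{a, b}"] assms f by (simp add: iso_iff)
  have q: "F Mod lower_central F i \<cong> H Mod lower_central H i" if "i \<ge> 1" for i
    using iso_trans[OF quot[OF that] lower_central_iso_quotient[OF G.is_group H f]] .
  show thesis
  proof
    show "group H" by fact
    show "\<exists>a\<in>carrier H. \<exists>b\<in>carrier H. generate H {a, b} = carrier H"
      using gen assms f.hom_closed by blast
    show "group_rank H = 2"
      using group_rank_eq_2[OF H _ _ gen q] assms f.hom_closed by simp
    show "\<not> H \<cong> F"
      using assms(6) iso_trans[OF is_isoI[OF f]] by blast
    show "F Mod lower_central F i \<cong> H Mod lower_central H i" if "i \<ge> 1" for i
      using q that .
    show "residually_nilpotent H \<longleftrightarrow> residually_nilpotent G"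
      using residually_nilpotent_iso[OF G.is_group H f] .
  qed
qed

end

section \<open>The residually nilpotent group\<close>

context cp_words
begin

abbreviation x0 where "x0 \<equiv> syl False (Suc 0)"
abbreviation y0 where "y0 \<equiv> syl True (Suc 0)"
abbreviation \<gamma> where "\<gamma> \<equiv> lower_central F"

definition sol :: "nat \<Rightarrow> (bool \<times> nat) list" where
  "sol i = (SOME b. b \<in> carrier F \<and> \<gamma> i #>\<^bsub>F\<^esub> F.rel x0 b = \<gamma> i #>\<^bsub>F\<^esub> y0)"

lemma sol: "sol i \<in> carrier F" "\<gamma> i #>\<^bsub>F\<^esub> F.rel x0 (sol i) = \<gamma> i #>\<^bsub>F\<^esub> y0"
proof -
  have "\<exists>b. b \<in> carrier F \<and> \<gamma> i #>\<^bsub>F\<^esub> F.rel x0 b = \<gamma> i #>\<^bsub>F\<^esub> y0"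
    using F.rel_solvable[of x0 y0 i] by auto
  from someI_ex[OF this] show "sol i \<in> carrier F" "\<gamma> i #>\<^bsub>F\<^esub> F.rel x0 (sol i) = \<gamma> i #>\<^bsub>F\<^esub> y0"
    by (simp_all add: sol_def)
qed

text \<open>The factor at index 0 is trivial, because \<open>lower_central\<close> is the whole
  group there.\<close>

definition nilprod :: "(nat \<Rightarrow> (bool \<times> nat) list set) monoid" where
  "nilprod = product_group UNIV (\<lambda>i. F Mod \<gamma> i)"

definition diag :: "(bool \<times> nat) list \<Rightarrow> nat \<Rightarrow> (bool \<times> nat) list set" where
  "diag w = (\<lambda>i. \<gamma> i #>\<^bsub>F\<^esub> w)"

text \<open>The components of \<open>dsol\<close> are chosen independently; compatibility is never needed.\<close>

definition dsol :: "nat \<Rightarrow> (bool \<times> nat) list set" where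
  "dsol = (\<lambda>i. \<gamma> i #>\<^bsub>F\<^esub> sol i)"

text \<open>The element \<open>diag y0\<close> belongs to this subgroup as well, being
  \<open>rel\<close> of the two generators by \<open>rel_dsol\<close>; hence all of
  \<open>diag\<close> followed by \<open>F\<close> maps into it.\<close>

definition G1 :: "(nat \<Rightarrow> (bool \<times> nat) list set) monoid" where
  "G1 = subgroup_generated nilprod {diag x0, dsol}"

lemma group_FMod: "group (F Mod \<gamma> i)"
  by (rule normal.factorgroup_is_group[OF F.lower_central_normal])

lemma hom_FMod: "(\<lambda>w. \<gamma> i #>\<^bsub>F\<^esub> w) \<in> hom F (F Mod \<gamma> i)"
  by (rule normal.r_coset_hom_Mod[OF F.lower_central_normal])

sublocale P: group nilprod
  unfolding nilprod_def by (rule product_group) (rule group_FMod)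

lemma carrier_nilprod: "f \<in> carrier nilprod \<longleftrightarrow> (\<forall>i. f i \<in> carrier (F Mod \<gamma> i))"
  by (auto simp: nilprod_def)

lemma mult_nilprod: "f \<otimes>\<^bsub>nilprod\<^esub> g = (\<lambda>i. f i \<otimes>\<^bsub>F Mod \<gamma> i\<^esub> g i)"
  by (simp add: nilprod_def restrict_def)

lemma one_nilprod: "\<one>\<^bsub>nilprod\<^esub> = (\<lambda>i. \<one>\<^bsub>F Mod \<gamma> i\<^esub>)"
  by (simp add: nilprod_def restrict_def)

lemma proj_hom: "(\<lambda>f. f i) \<in> hom nilprod (F Mod \<gamma> i)"
  by (auto simp: hom_def carrier_nilprod mult_nilprod simp del: mult_FactGroup)

lemma diag_hom: "diag \<in> hom F nilprod"
proof (rule homI)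
  show "diag w \<in> carrier nilprod" if "w \<in> carrier F" for w
    using that hom_in_carrier[OF hom_FMod] by (simp add: carrier_nilprod diag_def)
  show "diag (v \<otimes>\<^bsub>F\<^esub> w) = diag v \<otimes>\<^bsub>nilprod\<^esub> diag w" if "v \<in> carrier F" "w \<in> carrier F" for v w
    using that hom_mult[OF hom_FMod] by (simp add: diag_def mult_nilprod del: mult_FactGroup)
qed

lemma dsol_in: "dsol \<in> carrier nilprod"
  using sol(1) hom_in_carrier[OF hom_FMod] by (simp add: carrier_nilprod dsol_def)

lemma rel_dsol: "P.rel (diag x0) dsol = diag y0"
proof
  fix i
  have "P.rel (diag x0) dsol i = group.rel (F Mod \<gamma> i) (diag x0 i) (dsol i)"
    using hom_rel[OF P.is_group group_FMod proj_hom _ dsol_in] hom_in_carrier[OF diag_hom] by simp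
  also have "\<dots> = \<gamma> i #>\<^bsub>F\<^esub> F.rel x0 (sol i)"
    using hom_rel[OF F.is_group group_FMod hom_FMod _ sol(1)] by (simp add: diag_def dsol_def)
  finally show "P.rel (diag x0) dsol i = diag y0 i"
    by (simp add: sol diag_def)
qed

lemma gens_G1: "diag x0 \<in> carrier G1" "dsol \<in> carrier G1"
  using hom_in_carrier[OF diag_hom, of x0] dsol_in
  by (auto simp: G1_def carrier_subgroup_generated intro!: generate.incl)

lemma carrier_G1_subset: "carrier G1 \<subseteq> carrier nilprod"
  unfolding G1_def by (rule P.carrier_subgroup_generated_subset)

sublocale G1: group G1
  unfolding G1_def by (rule P.group_subgroup_generated)

lemma generate_G1: "generate G1 {diag x0, dsol} = carrier G1"
proof -
  have "{diag x0, dsol} \<subseteq> carrier nilprod"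
    using gens_G1 carrier_G1_subset by auto
  then have "carrier (subgroup_generated G1 {diag x0, dsol}) = generate G1 {diag x0, dsol}"
    using gens_G1 by (simp add: carrier_subgroup_generated Int_absorb1)
  then show ?thesis
    by (simp add: G1_def)
qed

lemma G1_hom: "h \<in> hom nilprod H \<Longrightarrow> h \<in> hom G1 H"
  unfolding G1_def by (rule P.hom_from_subgroup_generated)

lemma rel_G1: "G1.rel (diag x0) dsol = diag y0"
proof -
  have "(\<lambda>f. f) \<in> hom G1 nilprod"
    by (rule G1_hom) (simp add: hom_def)
  from hom_rel[OF G1.is_group P.is_group this gens_G1] show ?thesis
    by (simp add: rel_dsol)
qed

lemma diag_hom_G1: "diag \<in> hom F G1"
proof -
  have "diag y0 \<in> carrier G1"
    using G1.rel_closed[OF gens_G1] by (simp add: rel_G1)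
  then have "{diag x0, diag y0} \<subseteq> carrier G1"
    using gens_G1 by simp
  then have "generate nilprod {diag x0, diag y0} \<subseteq> carrier G1"
    unfolding G1_def by (intro P.generate_subgroup_incl P.subgroup_subgroup_generated)
  moreover interpret d: group_hom F nilprod diag
    using diag_hom by (simp add: group_hom_def group_hom_axioms_def F.is_group P.is_group)
  have "generate nilprod {diag x0, diag y0} = diag ` carrier F"
    using d.generate_img[of "{x0, y0}"] generate_F by simp
  ultimately show ?thesis
    using diag_hom unfolding G1_def by (simp add: hom_into_subgroup_eq_gen P.is_group)
qed

lemma G1_quotient: "F Mod \<gamma> i \<cong> G1 Mod lower_central G1 i"
proof (rule FactGroup_iso_via[OF F.is_group G1.is_group diag_hom_G1 G1.lower_central_normal])
  let ?M = "lower_central G1 i"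
  interpret M: normal ?M G1
    by (rule G1.lower_central_normal)
  interpret d: group_hom F G1 diag
    using diag_hom_G1 by (simp add: group_hom_def group_hom_axioms_def F.is_group G1.is_group)
  interpret pr: group_hom G1 "F Mod \<gamma> i" "\<lambda>f. f i"
    using G1_hom[OF proj_hom]
    by (simp add: group_hom_def group_hom_axioms_def group_FMod G1.is_group)
  \<comment> \<open>The quotient by the \<open>i\<close>-th term has trivial \<open>i\<close>-th
    term. Projecting to the coordinate \<open>i\<close> therefore detects which words
    \<open>diag\<close> sends into \<open>?M\<close>.\<close>
  have "lower_central (F Mod \<gamma> i) i = (\<lambda>w. \<gamma> i #>\<^bsub>F\<^esub> w) ` \<gamma> i"
    using lower_central_epi[OF F.is_group group_FMod hom_FMod] by (simp add: carrier_FactGroup)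
  also have "\<dots> \<subseteq> {\<gamma> i}"
    using F.normal_rcos_eq_self_iff[OF F.lower_central_normal] F.lower_central_subset by blast
  finally have triv: "lower_central (F Mod \<gamma> i) i \<subseteq> {\<gamma> i}" .
  show "\<gamma> i = {w \<in> carrier F. diag w \<in> ?M}"
  proof (intro equalityI subsetI)
    fix w assume "w \<in> \<gamma> i"
    then show "w \<in> {w \<in> carrier F. diag w \<in> ?M}"
      using lower_central_hom[OF F.is_group G1.is_group diag_hom_G1, of i] F.lower_central_subset by auto
  next
    fix w assume w: "w \<in> {w \<in> carrier F. diag w \<in> ?M}"
    then have "diag w i \<in> lower_central (F Mod \<gamma> i) i"
      using lower_central_hom[OF G1.is_group group_FMod G1_hom[OF proj_hom], of i i] by auto
    then have "\<gamma> i #>\<^bsub>F\<^esub> w = \<gamma> i"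
      using triv by (auto simp: diag_def)
    then show "w \<in> \<gamma> i"
      using w F.normal_rcos_eq_self_iff[OF F.lower_central_normal] by auto
  qed
  \<comment> \<open>Both \<open>dsol\<close> and \<open>diag (sol i)\<close> solve the equation
    modulo \<open>?M\<close>: the former exactly, the latter as the image of a solution modulo
    \<open>\<gamma> i\<close>. Uniqueness identifies their cosets.\<close>
  have "diag (F.rel x0 (sol i)) = G1.rel (diag x0) (diag (sol i))"
    by (rule hom_rel[OF F.is_group G1.is_group diag_hom_G1]) (auto simp: sol)
  moreover have "?M #>\<^bsub>G1\<^esub> diag (F.rel x0 (sol i)) = ?M #>\<^bsub>G1\<^esub> diag y0"
  proof -
    have "inv\<^bsub>F\<^esub> (F.rel x0 (sol i)) \<otimes>\<^bsub>F\<^esub> y0 \<in> \<gamma> i"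
      using F.normal_rcos_eq_iff[OF F.lower_central_normal] sol by simp
    then have "diag (inv\<^bsub>F\<^esub> (F.rel x0 (sol i)) \<otimes>\<^bsub>F\<^esub> y0) \<in> ?M"
      using lower_central_hom[OF F.is_group G1.is_group diag_hom_G1] by blast
    then show ?thesis
      using G1.normal_rcos_eq_iff[OF G1.lower_central_normal] sol by simp
  qed
  ultimately have "?M #>\<^bsub>G1\<^esub> G1.rel (diag x0) dsol = ?M #>\<^bsub>G1\<^esub> G1.rel (diag x0) (diag (sol i))"
    by (simp add: rel_G1)
  then have b: "?M #>\<^bsub>G1\<^esub> dsol = ?M #>\<^bsub>G1\<^esub> diag (sol i)"
    by (rule G1.rel_unique[OF gens_G1 d.hom_closed[OF sol(1)]])
  let ?q = "\<lambda>g. ?M #>\<^bsub>G1\<^esub> g"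
  interpret q: group_hom G1 "G1 Mod ?M" ?q
    using M.r_coset_hom_Mod M.factorgroup_is_group
    by (simp add: group_hom_def group_hom_axioms_def G1.is_group)
  have qd: "?q \<circ> diag \<in> hom F (G1 Mod ?M)"
    by (rule hom_compose[OF diag_hom_G1 q.homh])
  interpret qd: group_hom F "G1 Mod ?M" "?q \<circ> diag"
    using qd by (simp add: group_hom_def group_hom_axioms_def F.is_group q.H.is_group)
  \<comment> \<open>Both generators of the quotient now have representatives in the image of
    \<open>diag\<close>, so \<open>F\<close> maps onto it.\<close>
  have "carrier (G1 Mod ?M) = ?q ` generate G1 {diag x0, dsol}"
    by (simp add: generate_G1 carrier_FactGroup)
  also have "\<dots> = generate (G1 Mod ?M) {?q (diag x0), ?q dsol}"
    using q.generate_img[of "{diag x0, dsol}"] gens_G1 by simp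
  also have "\<dots> = (?q \<circ> diag) ` generate F {x0, sol i}"
    using qd.generate_img[of "{x0, sol i}"] sol b by simp
  also have "\<dots> \<subseteq> (?q \<circ> diag) ` carrier F"
    using F.generate_incl[of "{x0, sol i}"] sol by (intro image_mono) simp
  finally have "carrier (G1 Mod ?M) \<subseteq> (?q \<circ> diag) ` carrier F" .
  then show "\<exists>w\<in>carrier F. ?q g = ?q (diag w)" if "g \<in> carrier G1" for g
  proof -
    have "?q g \<in> (?q \<circ> diag) ` carrier F"
      using q.hom_closed[OF that] \<open>carrier (G1 Mod ?M) \<subseteq> (?q \<circ> diag) ` carrier F\<close> by blast
    then show ?thesis
      by auto
  qed
qed

text \<open>The coordinate \<open>i\<close> of an element of the intersection lies in the
  \<open>i\<close>-th term of \<open>F Mod \<gamma> i\<close>, which is trivial.\<close>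

lemma G1_residually_nilpotent: "residually_nilpotent G1"
proof -
  have "g = \<one>\<^bsub>G1\<^esub>" if g: "\<And>i. i \<ge> 1 \<Longrightarrow> g \<in> lower_central G1 i" for g
  proof -
    have G: "g \<in> carrier G1"
      using g[of 1] by simp
    have "g i = \<gamma> i" for i
    proof (cases "i = 0")
      \<comment> \<open>The intersection starts at index 1, so the coordinate 0 is settled by the
        triviality of its factor.\<close>
      case True
      have "g 0 \<in> carrier (F Mod \<gamma> 0)"
        using G carrier_G1_subset carrier_nilprod by blast
      then show ?thesis
        using True F.normal_rcos_eq_self_iff[OF F.lower_central_normal, of _ 0]
        by (auto simp: carrier_FactGroup)
    next
      case False
      have "g i \<in> lower_central (F Mod \<gamma> i) i"
        using g[of i] False lower_central_hom[OF G1.is_group group_FMod G1_hom[OF proj_hom], of i i] by auto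
      also have "\<dots> = (\<lambda>w. \<gamma> i #>\<^bsub>F\<^esub> w) ` \<gamma> i"
        using lower_central_epi[OF F.is_group group_FMod hom_FMod] by (simp add: carrier_FactGroup)
      also have "\<dots> \<subseteq> {\<gamma> i}"
        using F.normal_rcos_eq_self_iff[OF F.lower_central_normal] F.lower_central_subset by blast
      finally show ?thesis by simp
    qed
    then show ?thesis
      by (auto simp: G1_def one_nilprod)
  qed
  moreover have "\<one>\<^bsub>G1\<^esub> \<in> lower_central G1 i" for i
    using subgroup.one_closed normal_imp_subgroup G1.lower_central_normal by blast
  ultimately show ?thesis
    unfolding residually_nilpotent_def by auto
qed

lemma G1_not_iso:
  assumes "Factorial_Ring.prime p" "odd p" shows "\<not> G1 \<cong> F"
proof (rule not_iso_F[OF assms G1.is_group gens_G1])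
  interpret d: group_hom F G1 diag
    using diag_hom_G1 by (simp add: group_hom_def group_hom_axioms_def F.is_group G1.is_group)
  \<comment> \<open>The coordinate at index 2, the abelianization, already separates words with
    different exponent sums.\<close>
  have diag_neq: "diag u \<noteq> diag v"
    if "u \<in> carrier F" "v \<in> carrier F" "esum b u mod p \<noteq> esum b v mod p" for u v b
    using that esum_rcos by (metis diag_def)
  show "diag x0 \<noteq> \<one>\<^bsub>G1\<^esub>"
    using diag_neq[of x0 "\<one>\<^bsub>F\<^esub>" False] p_gt_1 esum_syl[of False False 1] by simp
  have "diag (x0 [^]\<^bsub>F\<^esub> p) = \<one>\<^bsub>G1\<^esub>" "diag (y0 [^]\<^bsub>F\<^esub> p) = \<one>\<^bsub>G1\<^esub>"
    by (simp_all add: syl_pow)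
  then show "diag x0 [^]\<^bsub>G1\<^esub> p = \<one>\<^bsub>G1\<^esub>" "G1.rel (diag x0) dsol [^]\<^bsub>G1\<^esub> p = \<one>\<^bsub>G1\<^esub>"
    using d.hom_nat_pow[of x0 p] d.hom_nat_pow[of y0 p] by (simp_all add: rel_G1)
  show "dsol \<noteq> diag x0 [^]\<^bsub>G1\<^esub> k" for k :: nat
  proof
    assume k: "dsol = diag x0 [^]\<^bsub>G1\<^esub> k"
    \<comment> \<open>If the solution were a power of \<open>diag x0\<close>, then by
      \<open>rel_pow\<close> so would be \<open>diag y0\<close>, contrary to the exponent sum of the
      second generator.\<close>
    have "diag y0 = G1.rel (diag x0) (diag x0 [^]\<^bsub>G1\<^esub> k)"
      unfolding k[symmetric] rel_G1 ..
    also have "\<dots> = diag x0 [^]\<^bsub>G1\<^esub> k"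
      by (rule G1.rel_pow[OF gens_G1(1)])
    finally have "diag y0 = diag (syl False k)"
      using d.hom_nat_pow[of x0 k] by (simp add: syl_pow)
    then show False
      using diag_neq[of y0 "syl False k" True] p_gt_1 by (simp add: esum_syl)
  qed
qed

end

section \<open>The group that is not residually nilpotent\<close>

context cp_words
begin

definition mersenne :: int where "mersenne = 2 ^ p - 1"

text \<open>Doubling has order \<open>p\<close> modulo \<open>2\<^sup>p - 1\<close>, so this defines an action of \<open>F\<close>.\<close>

definition act :: "(bool \<times> nat) list \<Rightarrow> int" where "act w = 2 ^ esum False w"

definition G2 :: "(int \<times> (bool \<times> nat) list) monoid" where
  "G2 = \<lparr>carrier = {0..<mersenne} \<times> carrier F,
     monoid.mult = (\<lambda>(a, v) (b, w). ((a + act v * b) mod mersenne, v \<otimes>\<^bsub>F\<^esub> w)), one = (0, \<one>\<^bsub>F\<^esub>)\<rparr>"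

lemma mersenne_gt_1: "1 < mersenne"
proof -
  have "(2::int) ^ 2 \<le> 2 ^ p"
    using p_gt_1 by (intro power_increasing) auto
  then show ?thesis by (simp add: mersenne_def)
qed

text \<open>Exponent sums are additive only modulo \<open>p\<close>, which is enough because the
  \<open>p\<close>-th power of 2 is 1 modulo \<open>mersenne\<close>.\<close>

lemma act_mult: "act (v \<otimes>\<^bsub>F\<^esub> w) mod mersenne = (act v * act w) mod mersenne"
proof -
  have "[(2::int) ^ n = 2 ^ (n mod p)] (mod mersenne)" for n
  proof -
    have "[(2::int) ^ p = 1] (mod mersenne)"
      by (simp add: mersenne_def cong_iff_dvd_diff)
    then have "[((2::int) ^ p) ^ (n div p) * 2 ^ (n mod p) = 1 ^ (n div p) * 2 ^ (n mod p)] (mod mersenne)"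
      by (intro cong_mult cong_pow cong_refl)
    then show ?thesis
      by (simp flip: power_mult power_add)
  qed
  from this[of "esum False (v \<otimes>\<^bsub>F\<^esub> w)"] this[of "esum False v + esum False w"]
  show ?thesis
    unfolding act_def power_add[symmetric] cong_def by (simp add: esum_mult)
qed

lemma act_one [simp]: "act \<one>\<^bsub>F\<^esub> = 1"
  by (simp add: act_def)

lemma act_syl [simp]: "act (syl True k) = 1" "act (syl False (Suc 0)) = 2"
  using p_gt_1 by (simp_all add: act_def esum_def syl_def)

lemma carrier_G2: "(a, w) \<in> carrier G2 \<longleftrightarrow> 0 \<le> a \<and> a < mersenne \<and> w \<in> carrier F"
  and mult_G2: "(a, v) \<otimes>\<^bsub>G2\<^esub> (b, w) = ((a + act v * b) mod mersenne, v \<otimes>\<^bsub>F\<^esub> w)"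
  and one_G2: "\<one>\<^bsub>G2\<^esub> = (0, \<one>\<^bsub>F\<^esub>)"
  by (auto simp: G2_def)

lemma carrier_G2E:
  assumes "g \<in> carrier G2"
  obtains a w where "g = (a, w)" "0 \<le> a" "a < mersenne" "w \<in> carrier F"
  using assms by (cases g) (auto simp: carrier_G2)

sublocale G2: group G2
proof (rule groupI)
  fix g h k assume "g \<in> carrier G2" "h \<in> carrier G2" "k \<in> carrier G2"
  then obtain a u b v c w where e: "g = (a, u)" "h = (b, v)" "k = (c, w)"
    and F: "u \<in> carrier F" "v \<in> carrier F" "w \<in> carrier F"
    by (elim carrier_G2E)
  \<comment> \<open>The integer \<open>act\<close> is multiplicative only modulo
    \<open>mersenne\<close>, so associativity is checked as a congruence.\<close>
  have "[act (u \<otimes>\<^bsub>F\<^esub> v) = act u * act v] (mod mersenne)"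
    by (simp add: cong_def act_mult)
  then have "[a + act u * b + act (u \<otimes>\<^bsub>F\<^esub> v) * c = a + act u * b + act u * act v * c] (mod mersenne)"
    by (intro cong_add cong_scalar_right cong_refl)
  then have "((a + act u * b) mod mersenne + act (u \<otimes>\<^bsub>F\<^esub> v) * c) mod mersenne = (a + act u * (b + act v * c)) mod mersenne"
    by (simp only: cong_def mod_add_left_eq distrib_left mult.assoc add.assoc)
  also have "\<dots> = (a + act u * ((b + act v * c) mod mersenne)) mod mersenne"
    by (metis mod_add_right_eq mod_mult_right_eq)
  finally show "g \<otimes>\<^bsub>G2\<^esub> h \<otimes>\<^bsub>G2\<^esub> k = g \<otimes>\<^bsub>G2\<^esub> (h \<otimes>\<^bsub>G2\<^esub> k)"
    using F by (simp add: e mult_G2 F.m_assoc)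
next
  fix g assume "g \<in> carrier G2"
  then obtain a w where g: "g = (a, w)" "w \<in> carrier F"
    by (elim carrier_G2E)
  have "((- (act (inv\<^bsub>F\<^esub> w) * a)) mod mersenne, inv\<^bsub>F\<^esub> w) \<otimes>\<^bsub>G2\<^esub> g = \<one>\<^bsub>G2\<^esub>"
    using g by (simp add: mult_G2 one_G2 mod_simps)
  moreover have "((- (act (inv\<^bsub>F\<^esub> w) * a)) mod mersenne, inv\<^bsub>F\<^esub> w) \<in> carrier G2"
    using g mersenne_gt_1 by (simp add: carrier_G2)
  ultimately show "\<exists>h\<in>carrier G2. h \<otimes>\<^bsub>G2\<^esub> g = \<one>\<^bsub>G2\<^esub>"
    by blast
qed (use mersenne_gt_1 in \<open>auto simp: carrier_G2 mult_G2 one_G2 elim!: carrier_G2E\<close>)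

definition emb :: "(bool \<times> nat) list \<Rightarrow> int \<times> (bool \<times> nat) list" where "emb w = (0, w)"

lemma emb_hom: "emb \<in> hom F G2"
  using mersenne_gt_1 by (intro homI) (auto simp: emb_def carrier_G2 mult_G2)

lemma snd_hom: "snd \<in> hom G2 F"
  by (intro homI) (auto simp: mult_G2 elim!: carrier_G2E)

sublocale emb: group_hom F G2 emb
  using emb_hom by (simp add: group_hom_def group_hom_axioms_def F.is_group G2.is_group)

text \<open>Conjugation by \<open>?x\<close> squares every \<open>?n\<close> in the kernel of
  \<open>snd\<close>, so the commutator of \<open>?x\<close> and \<open>?n\<close> is
  \<open>?n\<close> itself. Thus \<open>?n\<close> passes from each term to the next.\<close>

lemma kernel_in_lower_central:
  assumes "0 \<le> a" "a < mersenne" shows "(a, \<one>\<^bsub>F\<^esub>) \<in> lower_central G2 i"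
proof (induction i rule: induct_nat_012)
  case (ge2 k)
  let ?x = "emb (syl False (Suc 0))" and ?n = "(a, \<one>\<^bsub>F\<^esub>)"
  have x: "?x \<in> carrier G2" and n: "?n \<in> carrier G2"
    using assms emb.hom_closed[of "syl False (Suc 0)"] by (auto simp: carrier_G2)
  have "?n \<otimes>\<^bsub>G2\<^esub> ?n \<otimes>\<^bsub>G2\<^esub> ?x = ?x \<otimes>\<^bsub>G2\<^esub> ?n"
    using assms by (simp add: emb_def mult_G2 algebra_simps)
  then have "?x \<otimes>\<^bsub>G2\<^esub> ?n \<otimes>\<^bsub>G2\<^esub> inv\<^bsub>G2\<^esub> ?x \<otimes>\<^bsub>G2\<^esub> inv\<^bsub>G2\<^esub> ?n
      = ?n \<otimes>\<^bsub>G2\<^esub> ?n \<otimes>\<^bsub>G2\<^esub> ?x \<otimes>\<^bsub>G2\<^esub> inv\<^bsub>G2\<^esub> ?x \<otimes>\<^bsub>G2\<^esub> inv\<^bsub>G2\<^esub> ?n"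
    by simp
  also have "\<dots> = ?n"
    using x n by (simp add: G2.m_assoc)
  finally show ?case
    using G2.commutator_in_lower_central[OF x ge2(2)] by simp
qed (use assms in \<open>auto simp: carrier_G2\<close>)

lemma G2_decomp:
  "0 \<le> a \<Longrightarrow> a < mersenne \<Longrightarrow> w \<in> carrier F \<Longrightarrow> (a, w) = (a, \<one>\<^bsub>F\<^esub>) \<otimes>\<^bsub>G2\<^esub> emb w"
  by (simp add: emb_def mult_G2)

text \<open>The retraction \<open>snd\<close> shows that \<open>emb\<close> reflects membership in
  the lower central series. Modulo each term the kernel of \<open>snd\<close> vanishes, so
  \<open>emb\<close> reaches every coset.\<close>

lemma G2_quotient: "F Mod lower_central F i \<cong> G2 Mod lower_central G2 i"
proof (rule FactGroup_iso_via[OF F.is_group G2.is_group emb_hom G2.lower_central_normal])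
  show "lower_central F i = {w \<in> carrier F. emb w \<in> lower_central G2 i}"
  proof (intro equalityI subsetI)
    fix w assume "w \<in> lower_central F i"
    then show "w \<in> {w \<in> carrier F. emb w \<in> lower_central G2 i}"
      using lower_central_hom[OF F.is_group G2.is_group emb_hom, of i] F.lower_central_subset by auto
  next
    fix w assume "w \<in> {w \<in> carrier F. emb w \<in> lower_central G2 i}"
    then have "snd (emb w) \<in> lower_central F i"
      using lower_central_hom[OF G2.is_group F.is_group snd_hom, of i] by blast
    then show "w \<in> lower_central F i"
      by (simp add: emb_def)
  qed
next
  fix g assume "g \<in> carrier G2"
  then obtain a w where g: "g = (a, w)" "0 \<le> a" "a < mersenne" "w \<in> carrier F"
    by (elim carrier_G2E)
  let ?M = "lower_central G2 i"
  have n: "(a, \<one>\<^bsub>F\<^esub>) \<in> ?M" "(a, \<one>\<^bsub>F\<^esub>) \<in> carrier G2"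
    using g kernel_in_lower_central by (auto simp: carrier_G2)
  have "?M #>\<^bsub>G2\<^esub> g = ?M #>\<^bsub>G2\<^esub> (a, \<one>\<^bsub>F\<^esub>) #>\<^bsub>G2\<^esub> emb w"
    using G2_decomp[OF g(2-4)] n g emb.hom_closed[OF g(4)]
    by (simp add: G2.coset_mult_assoc G2.lower_central_subset)
  also have "?M #>\<^bsub>G2\<^esub> (a, \<one>\<^bsub>F\<^esub>) = ?M"
    using n G2.normal_rcos_eq_self_iff[OF G2.lower_central_normal] by simp
  finally show "\<exists>w\<in>carrier F. ?M #>\<^bsub>G2\<^esub> g = ?M #>\<^bsub>G2\<^esub> emb w"
    using g(4) by blast
qed

lemma G2_not_residually_nilpotent: "\<not> residually_nilpotent G2"
proof
  assume "residually_nilpotent G2"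
  then have "(\<Inter>k\<in>{1..}. lower_central G2 k) = {\<one>\<^bsub>G2\<^esub>}"
    by (simp add: residually_nilpotent_def)
  moreover have "(1, \<one>\<^bsub>F\<^esub>) \<in> (\<Inter>k\<in>{1..}. lower_central G2 k)"
    using kernel_in_lower_central[of 1] mersenne_gt_1 by simp
  ultimately show False
    by (simp add: one_G2)
qed

lemma G2_not_iso:
  assumes "Factorial_Ring.prime p" "odd p" shows "\<not> G2 \<cong> F"
proof -
  let ?x = "emb (syl False (Suc 0))" and ?n = "(1, \<one>\<^bsub>F\<^esub>)"
  have x: "?x \<in> carrier G2" and n: "?n \<in> carrier G2"
    using mersenne_gt_1 emb.hom_closed[of "syl False (Suc 0)"] by (auto simp: carrier_G2)
  have pow: "?x [^]\<^bsub>G2\<^esub> (k::nat) = emb (syl False k)" for k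
    using emb.hom_nat_pow[of "syl False (Suc 0)" k] by (simp add: syl_pow)
  \<comment> \<open>This relation says that \<open>rel\<close> of \<open>?x\<close> and
    \<open>?n\<close> is trivial, although \<open>?n\<close> has nonzero first component and hence
    is not a power of \<open>?x\<close>.\<close>
  have "?n \<otimes>\<^bsub>G2\<^esub> ?n \<otimes>\<^bsub>G2\<^esub> ?x = ?x \<otimes>\<^bsub>G2\<^esub> ?n"
    by (simp add: emb_def mult_G2)
  then have rel: "G2.rel ?x ?n = \<one>\<^bsub>G2\<^esub>"
    using x n by (simp add: G2.rel_def G2.m_assoc)
  show ?thesis
  proof (rule not_iso_F[OF assms G2.is_group x n])
    show "?x \<noteq> \<one>\<^bsub>G2\<^esub>"
      using p_gt_1 by (simp add: emb_def one_G2 one_F syl_def)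
    show "?x [^]\<^bsub>G2\<^esub> p = \<one>\<^bsub>G2\<^esub>"
      by (simp add: pow)
    show "G2.rel ?x ?n [^]\<^bsub>G2\<^esub> p = \<one>\<^bsub>G2\<^esub>"
      by (simp add: rel)
    show "?n \<noteq> ?x [^]\<^bsub>G2\<^esub> k" for k :: nat
      unfolding pow by (simp add: emb_def)
  qed
qed

text \<open>The second generator of \<open>F\<close> is shifted by some \<open>s\<close> in the
  normal factor with \<open>int p * s = mersenne - 1\<close>; Fermat's theorem provides it. The
  \<open>p\<close>-th power of the shifted generator then represents -1 in this cyclic factor, so
  the factor lies in the generated subgroup, and the shift can be undone.\<close>

lemma generate_G2:
  assumes "Factorial_Ring.prime p" "odd p"
  obtains a b where "a \<in> carrier G2" "b \<in> carrier G2" "generate G2 {a, b} = carrier G2"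
proof
  define s :: int where "s = (2 ^ p - 2) div int p"
  have "p \<noteq> 2"
    using assms(2) by auto
  then have "\<not> p dvd 2"
    using p_gt_1 by (auto dest: dvd_imp_le)
  then have "[2 ^ (p - 1) = 1] (mod p)"
    using fermat_theorem[OF assms(1), of 2] by blast
  then have "[2 * 2 ^ (p - 1) = 2 * 1] (mod p)"
    by (rule cong_scalar_left)
  then have "[2 ^ p = 2] (mod p)"
    using p_gt_1 power_Suc[of "2::nat" "p - 1"] by simp
  then have "[2 ^ p = 2] (mod int p)"
    by (metis cong_int_iff of_nat_numeral of_nat_power)
  then have "int p dvd 2 ^ p - 2"
    by (simp add: cong_iff_dvd_diff)
  then have ps: "int p * s = mersenne - 1"
    by (simp add: s_def mersenne_def)
  have s: "0 \<le> s" "s < mersenne"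
  proof -
    show "0 \<le> s"
      using mersenne_gt_1 p_gt_1 by (simp add: s_def mersenne_def pos_imp_zdiv_nonneg_iff)
    then have "1 * s \<le> int p * s"
      using p_gt_1 by (intro mult_right_mono) auto
    then show "s < mersenne"
      using ps by simp
  qed
  let ?x = "emb (syl False (Suc 0))" and ?y = "(s, syl True (Suc 0))"
  show x: "?x \<in> carrier G2" and y: "?y \<in> carrier G2"
    using s emb.hom_closed[of "syl False (Suc 0)"] by (auto simp: carrier_G2)
  let ?K = "generate G2 {?x, ?y}"
  interpret K: subgroup ?K G2
    using x y by (intro G2.generate_is_subgroup) auto
  have in_K: "?x \<in> ?K" "?y \<in> ?K"
    by (auto intro: generate.incl)
  have K_pow: "g [^]\<^bsub>G2\<^esub> (k::nat) \<in> ?K" if "g \<in> ?K" for g k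
    using G2.subgroup_int_pow_closed[OF K.subgroup_axioms that, of "int k"] by (simp add: int_pow_int)
  have y_pow: "?y [^]\<^bsub>G2\<^esub> k = ((int k * s) mod mersenne, syl True k)" for k :: nat
  proof (induction k)
    case (Suc k)
    then show ?case
      using mersenne_gt_1 by (simp add: mult_G2 syl_add mod_simps algebra_simps)
  qed (simp add: one_G2)
  have n_pow: "(mersenne - 1, \<one>\<^bsub>F\<^esub>) [^]\<^bsub>G2\<^esub> k = ((int k * (mersenne - 1)) mod mersenne, \<one>\<^bsub>F\<^esub>)" for k :: nat
  proof (induction k)
    case (Suc k)
    then show ?case
      by (simp add: mult_G2 mod_simps) (simp add: algebra_simps)
  qed (simp add: one_G2)
  have "(mersenne - 1) mod mersenne = mersenne - 1"
    by (rule mod_pos_pos_trivial) (use mersenne_gt_1 in auto)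
  then have "(mersenne - 1, \<one>\<^bsub>F\<^esub>) \<in> ?K"
    using K_pow[OF in_K(2), of p] unfolding y_pow ps by simp
  have N: "(a, \<one>\<^bsub>F\<^esub>) \<in> ?K" if "0 \<le> a" "a < mersenne" for a
  proof -
    \<comment> \<open>Since \<open>mersenne - 1\<close> represents -1, its multiple by
      \<open>mersenne - a\<close> represents \<open>a\<close>.\<close>
    have "(mersenne - a) * (mersenne - 1) = a + mersenne * (mersenne - a - 1)"
      by (simp add: algebra_simps)
    then have "((mersenne - a) * (mersenne - 1)) mod mersenne = a"
      using that by (simp del: left_diff_distrib right_diff_distrib)
    then show ?thesis
      using K_pow[OF \<open>(mersenne - 1, \<one>\<^bsub>F\<^esub>) \<in> ?K\<close>, of "nat (mersenne - a)"] that by (simp add: n_pow)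
  qed
  have "emb (syl True (Suc 0)) = inv\<^bsub>G2\<^esub> (s, \<one>\<^bsub>F\<^esub>) \<otimes>\<^bsub>G2\<^esub> ?y"
    using G2_decomp[OF s, of "syl True (Suc 0)"] s emb.hom_closed[of "syl True (Suc 0)"]
    by (simp add: carrier_G2)
  then have "emb (syl True (Suc 0)) \<in> ?K"
    using N[OF s] in_K by simp
  then have "generate G2 {?x, emb (syl True (Suc 0))} \<subseteq> ?K"
    using in_K by (intro G2.generate_subgroup_incl K.subgroup_axioms) simp
  then have emb: "emb w \<in> ?K" if "w \<in> carrier F" for w
    using emb.generate_img[of "{syl False (Suc 0), syl True (Suc 0)}"] generate_F that by auto
  show "?K = carrier G2"
  proof
    show "carrier G2 \<subseteq> ?K"
    proof
      fix g assume "g \<in> carrier G2"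
      then obtain a w where g: "g = (a, w)" "0 \<le> a" "a < mersenne" "w \<in> carrier F"
        by (elim carrier_G2E)
      then show "g \<in> ?K"
        using G2_decomp[OF g(2-4)] K.m_closed[OF N emb] by simp
    qed
  qed (rule K.subset)
qed

end

theorem theorem2:
  fixes p :: nat
  assumes "Factorial_Ring.prime p" and "odd p"
  shows "\<exists>(G1 :: nat monoid) (G2 :: nat monoid).
           group G1 \<and> group G2 \<and>
           (\<exists>a\<in>carrier G1. \<exists>b\<in>carrier G1. generate G1 {a, b} = carrier G1) \<and>
           (\<exists>a\<in>carrier G2. \<exists>b\<in>carrier G2. generate G2 {a, b} = carrier G2) \<and>
           group_rank G1 = 2 \<and> group_rank G2 = 2 \<and>
           \<not> (G1 \<cong> CpCp p) \<and> \<not> (G2 \<cong> CpCp p) \<and>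
           (\<forall>i\<ge>1. (G1 Mod lower_central G1 i) \<cong> (G2 Mod lower_central G2 i) \<and>
                   (G2 Mod lower_central G2 i) \<cong> (CpCp p Mod lower_central (CpCp p) i)) \<and>
           residually_nilpotent G1 \<and> \<not> residually_nilpotent G2"
proof -
  interpret cp_words p
    using prime_gt_1_nat[OF assms(1)] by unfold_locales
  obtain H1 :: "nat monoid" where H1: "group H1"
    "\<exists>a\<in>carrier H1. \<exists>b\<in>carrier H1. generate H1 {a, b} = carrier H1" "group_rank H1 = 2" "\<not> H1 \<cong> F"
    "\<And>i. i \<ge> 1 \<Longrightarrow> F Mod lower_central F i \<cong> H1 Mod lower_central H1 i"
    "residually_nilpotent H1 \<longleftrightarrow> residually_nilpotent G1"
    by (rule transport_to_nat[OF G1.is_group gens_G1 generate_G1 G1_quotient G1_not_iso[OF assms]]) blast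
  obtain a b where ab: "a \<in> carrier G2" "b \<in> carrier G2" "generate G2 {a, b} = carrier G2"
    using generate_G2[OF assms] .
  obtain H2 :: "nat monoid" where H2: "group H2"
    "\<exists>a\<in>carrier H2. \<exists>b\<in>carrier H2. generate H2 {a, b} = carrier H2" "group_rank H2 = 2" "\<not> H2 \<cong> F"
    "\<And>i. i \<ge> 1 \<Longrightarrow> F Mod lower_central F i \<cong> H2 Mod lower_central H2 i"
    "residually_nilpotent H2 \<longleftrightarrow> residually_nilpotent G2"
    by (rule transport_to_nat[OF G2.is_group ab G2_quotient G2_not_iso[OF assms]]) blast
  have sym: "H Mod lower_central H i \<cong> F Mod lower_central F i"
    if "F Mod lower_central F i \<cong> H Mod lower_central H i" for H :: "nat monoid" and i
    using group.iso_sym[OF group_FMod that] .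
  show ?thesis
  proof (rule exI[of _ H1], rule exI[of _ H2], intro conjI allI impI)
    fix i :: nat assume "1 \<le> i"
    show "H1 Mod lower_central H1 i \<cong> H2 Mod lower_central H2 i"
      by (rule iso_trans[OF sym[OF H1(5)] H2(5)]) fact+
    show "H2 Mod lower_central H2 i \<cong> F Mod lower_central F i"
      by (rule sym[OF H2(5)]) fact
  qed (use H1 H2 G1_residually_nilpotent G2_not_residually_nilpotent in auto)
qed

end
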